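(* Let $\mathfrak h$ be a finite-dimensional abelian Lie algebra over $k=\mathbb C$ with a non-degenerate symmetric bilinear form $(-,-)$ and Casimir element $\Omega$. Let $A$ be a commutative algebra in the braided category $\mathcal C(\mathfrak h,\Omega)$ which has a non-degenerate multiplicative bilinear form and has trivial subalgebra of invariants $A^{\mathfrak h}=k$. Then $A$ has the form $k[\mathfrak l,\alpha]$, where $\mathfrak l$ is a subgroup of $\mathfrak h$ such that the restriction of the form to $\mathfrak l$ is integer and even: $$(x,y)\in\mathbb Z,\qquad (x,x)\in 2\mathbb Z,\qquad x,y\in\mathfrak l.$$ The cohomology class of the 2-cocycle $\alpha$ (and hence the isomorphism class of $k[\mathfrak l,\alpha]$) is uniquely defined by the condition $$\frac{\alpha(x,y)}{\alpha(y,x)}=e^{\pi i (x,y)},\qquad x,y\in\mathfrak l .$$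
   Context: The Casimir element is $\Omega=\sum_i u_i\otimes u_i\in\mathfrak h\otimes\mathfrak h$, where $(u_i)$ is an orthonormal basis of $\mathfrak h$. An $\mathfrak h$-module $V$ is locally finite if for any $x\in\mathfrak h$ and $v\in V$ there is a nonzero polynomial $f(t)$ with $f(x)v=0$ (equivalently, every cyclic submodule is finite dimensional). $\mathcal C(\mathfrak h,\Omega)$ is the category of locally finite $\mathfrak h$-modules with the ordinary tensor product and associativity constraint and with braiding $c_{M,N}(m\otimes n)=e^{\pi i\Omega}(n\otimes m)$, where $m\in M$, $n\in N$. An algebra $A$ in $\mathcal C(\mathfrak h,\Omega)$ is an associative unital algebra that is a locally finite $\mathfrak h$-module, with $\mathfrak h$ acting by derivations. With multiplication $\mu$, it is commutative if $\mu(e^{\pi i\Omega}(b\otimes a))=ab$ for all $a,b\in A$. A bilinear form $\beta:A\otimes A\to k$ is multiplicative if $\beta(ab,c)=\beta(a,bc)$ for all $a,b,c\in A$. $A^{\mathfrak h}=\{a\in A\mid z(a)=0\ \forall z\in\mathfrak h\}$. For a subgroup $\mathfrak l\subset\mathfrak h$ and a normalised 2-cocycle $\alpha:\mathfrak l\times\mathfrak l\to k^{\times}$ (trivial coefficients), the skew group algebra $k[\mathfrak l,\alpha]$ has basis $e_x$, $x\in\mathfrak l$, multiplication $e_xe_y=\alpha(x,y)e_{x+y}$, and $\mathfrak h$-action $z(e_x)=(x,z)e_x$ for $z\in\mathfrak h$.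
   Formalization: The non-degenerate multiplicative bilinear form is required to be h-invariant (a morphism A⊗A→k in the category); without this the claim fails, e.g. for A=C[t], h=⟨p,q⟩ a hyperbolic plane, p=d/dt, q=0, β(f,g)=∫₀¹fg. *)

theory Defs
  imports
    Complex_Main
    "HOL-Library.Poly_Mapping"
    "HOL-Computational_Algebra.Polynomial"
begin

section \<open>Complex vector spaces and algebras\<close>

class complex_vector = ab_group_add +
  fixes scaleC :: "complex \<Rightarrow> 'a \<Rightarrow> 'a"  (infixr \<open>*\<^sub>C\<close> 75)
  assumes scaleC_add_right: "c *\<^sub>C (x + y) = c *\<^sub>C x + c *\<^sub>C y"
    and scaleC_add_left: "(c + d) *\<^sub>C x = c *\<^sub>C x + d *\<^sub>C x"
    and scaleC_scaleC: "c *\<^sub>C d *\<^sub>C x = (c * d) *\<^sub>C x"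
    and scaleC_one: "1 *\<^sub>C x = x"

global_interpretation cvs: vector_space "scaleC :: complex \<Rightarrow> 'a \<Rightarrow> 'a::complex_vector"
  by standard (simp_all add: scaleC_add_right scaleC_add_left scaleC_scaleC scaleC_one)

class complex_algebra_1 = complex_vector + ring_1 +
  assumes mult_scaleC_left: "(c *\<^sub>C x) * y = c *\<^sub>C (x * y)"
    and mult_scaleC_right: "x * (c *\<^sub>C y) = c *\<^sub>C (x * y)"

abbreviation clinear :: "('a::complex_vector \<Rightarrow> 'b::complex_vector) \<Rightarrow> bool" where
  "clinear \<equiv> Vector_Spaces.linear scaleC scaleC"

lemma clinear_iff:
  "clinear f \<longleftrightarrow> (\<forall>x y. f (x + y) = f x + f y) \<and> (\<forall>c x. f (c *\<^sub>C x) = c *\<^sub>C f x)"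
  unfolding Vector_Spaces.linear_iff
  by (simp add: cvs.vector_space_axioms)

definition cbilinear ::
  "('a::complex_vector \<Rightarrow> 'b::complex_vector \<Rightarrow> 'c::complex_vector) \<Rightarrow> bool" where
  "cbilinear B \<longleftrightarrow> (\<forall>y. clinear (\<lambda>x. B x y)) \<and> (\<forall>x. clinear (\<lambda>y. B x y))"

instantiation complex :: complex_vector
begin
definition scaleC_complex :: "complex \<Rightarrow> complex \<Rightarrow> complex" where
  "scaleC_complex c z = c * z"
instance
  by standard (simp_all add: scaleC_complex_def algebra_simps)
end

instantiation poly_mapping :: (type, complex_vector) complex_vector
begin
lift_definition scaleC_poly_mapping :: "complex \<Rightarrow> ('a \<Rightarrow>\<^sub>0 'b) \<Rightarrow> 'a \<Rightarrow>\<^sub>0 'b"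
  is "\<lambda>c f x. c *\<^sub>C f x"
  by (rule finite_subset[rotated]) auto
instance
  by standard (transfer, simp add: fun_eq_iff algebra_simps)+
end

lemma lookup_scaleC [simp]:
  "Poly_Mapping.lookup (c *\<^sub>C f) x = c *\<^sub>C Poly_Mapping.lookup f x"
  by transfer simp

section \<open>The tensor product of complex vector spaces\<close>

text \<open>Linear extension to the free vector space \<open>'x \<Rightarrow>\<^sub>0 complex\<close> of a map given on its
  basis \<open>'x\<close>.\<close>

definition free_lift :: "('x \<Rightarrow> 'c::complex_vector) \<Rightarrow> ('x \<Rightarrow>\<^sub>0 complex) \<Rightarrow> 'c" where
  "free_lift f p = (\<Sum>x\<in>Poly_Mapping.keys p. Poly_Mapping.lookup p x *\<^sub>C f x)"

lemma free_lift_superset: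
  assumes "finite S" "Poly_Mapping.keys p \<subseteq> S"
  shows "free_lift f p = (\<Sum>x\<in>S. Poly_Mapping.lookup p x *\<^sub>C f x)"
  unfolding free_lift_def using assms
  by (intro sum.mono_neutral_left) (auto simp: in_keys_iff)

lemma clinear_free_lift: "clinear (free_lift f)"
proof -
  have "free_lift f (p + q) = free_lift f p + free_lift f q" for p q
  proof -
    let ?S = "Poly_Mapping.keys p \<union> Poly_Mapping.keys q"
    have "Poly_Mapping.keys (p + q) \<subseteq> ?S" by (rule Poly_Mapping.keys_add)
    then show ?thesis
      by (simp add: free_lift_superset[of ?S] lookup_add scaleC_add_left sum.distrib)
  qed
  moreover have "free_lift f (c *\<^sub>C p) = c *\<^sub>C free_lift f p" for c p
  proof -
    have "Poly_Mapping.keys (c *\<^sub>C p) \<subseteq> Poly_Mapping.keys p"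
      by (auto simp: in_keys_iff scaleC_complex_def)
    then show ?thesis
      by (simp add: free_lift_superset[of "Poly_Mapping.keys p"] cvs.scale_sum_right
          scaleC_complex_def)
  qed
  ultimately show ?thesis by (simp add: clinear_iff)
qed

lemma free_lift_single [simp]: "free_lift f (Poly_Mapping.single x c) = c *\<^sub>C f x"
  by (cases "c = 0") (simp_all add: free_lift_def)

abbreviation free_pair :: "'a \<Rightarrow> 'b \<Rightarrow> ('a \<times> 'b) \<Rightarrow>\<^sub>0 complex" where
  "free_pair x y \<equiv> Poly_Mapping.single (x, y) 1"

definition tensor_relators ::
  "(('a::complex_vector \<times> 'b::complex_vector) \<Rightarrow>\<^sub>0 complex) set" where
  "tensor_relators =
     {free_pair (x + x') y - free_pair x y - free_pair x' y | x x' y. True} \<union>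
     {free_pair x (y + y') - free_pair x y - free_pair x y' | x y y'. True} \<union>
     {free_pair (c *\<^sub>C x) y - c *\<^sub>C free_pair x y | c x y. True} \<union>
     {free_pair x (c *\<^sub>C y) - c *\<^sub>C free_pair x y | c x y. True}"

definition tensor_eq ::
  "(('a::complex_vector \<times> 'b::complex_vector) \<Rightarrow>\<^sub>0 complex) \<Rightarrow>
   (('a \<times> 'b) \<Rightarrow>\<^sub>0 complex) \<Rightarrow> bool" where
  "tensor_eq p q \<longleftrightarrow> p - q \<in> cvs.span tensor_relators"

lemma equivp_tensor_eq:
  "equivp (tensor_eq ::
     (('a::complex_vector \<times> 'b::complex_vector) \<Rightarrow>\<^sub>0 complex) \<Rightarrow> _)"
proof (intro equivpI reflpI sympI transpI)
  fix p q r :: "('a \<times> 'b) \<Rightarrow>\<^sub>0 complex"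
  show "tensor_eq p p" by (simp add: tensor_eq_def cvs.span_zero)
  assume pq: "tensor_eq p q"
  then have "- (p - q) \<in> cvs.span tensor_relators"
    unfolding tensor_eq_def by (rule cvs.span_neg)
  then show "tensor_eq q p" by (simp add: tensor_eq_def)
  assume "tensor_eq q r"
  with pq have "(p - q) + (q - r) \<in> cvs.span tensor_relators"
    unfolding tensor_eq_def by (rule cvs.span_add)
  then show "tensor_eq p r" by (simp add: tensor_eq_def)
qed

quotient_type (overloaded) ('a, 'b) tensor =
  "('a::complex_vector \<times> 'b::complex_vector) \<Rightarrow>\<^sub>0 complex" / tensor_eq
  by (rule equivp_tensor_eq)

instantiation tensor :: (complex_vector, complex_vector) complex_vector
begin

lift_definition zero_tensor :: "('a, 'b) tensor" is 0 .

lift_definition plus_tensor :: "('a, 'b) tensor \<Rightarrow> ('a, 'b) tensor \<Rightarrow> ('a, 'b) tensor"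
  is "(+)"
proof -
  fix p p' q q' :: "('a \<times> 'b) \<Rightarrow>\<^sub>0 complex"
  assume "tensor_eq p p'" "tensor_eq q q'"
  then have "(p - p') + (q - q') \<in> cvs.span tensor_relators"
    unfolding tensor_eq_def by (rule cvs.span_add)
  then show "tensor_eq (p + q) (p' + q')"
    by (simp add: tensor_eq_def algebra_simps)
qed

lift_definition uminus_tensor :: "('a, 'b) tensor \<Rightarrow> ('a, 'b) tensor" is uminus
proof -
  fix p p' :: "('a \<times> 'b) \<Rightarrow>\<^sub>0 complex"
  assume "tensor_eq p p'"
  then have "- (p - p') \<in> cvs.span tensor_relators"
    unfolding tensor_eq_def by (rule cvs.span_neg)
  then show "tensor_eq (- p) (- p')" by (simp add: tensor_eq_def)
qed

lift_definition minus_tensor :: "('a, 'b) tensor \<Rightarrow> ('a, 'b) tensor \<Rightarrow> ('a, 'b) tensor"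
  is "(-)"
proof -
  fix p p' q q' :: "('a \<times> 'b) \<Rightarrow>\<^sub>0 complex"
  assume "tensor_eq p p'" "tensor_eq q q'"
  then have "(p - p') - (q - q') \<in> cvs.span tensor_relators"
    unfolding tensor_eq_def by (rule cvs.span_diff)
  then show "tensor_eq (p - q) (p' - q')"
    by (simp add: tensor_eq_def algebra_simps)
qed

lift_definition scaleC_tensor :: "complex \<Rightarrow> ('a, 'b) tensor \<Rightarrow> ('a, 'b) tensor" is scaleC
  unfolding tensor_eq_def cvs.scale_right_diff_distrib[symmetric] by (rule cvs.span_scale)

instance
proof
  have eq: "tensor_eq p q" if "p = q" for p q :: "('a \<times> 'b) \<Rightarrow>\<^sub>0 complex"
    using that by (simp add: tensor_eq_def cvs.span_zero)
  fix r s t :: "('a, 'b) tensor" and c d :: complex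
  show "r + s + t = r + (s + t)" by transfer (rule eq, simp add: add.assoc)
  show "r + s = s + r" by transfer (rule eq, simp add: add.commute)
  show "0 + r = r" by transfer (rule eq, simp)
  show "- r + r = 0" by transfer (rule eq, simp)
  show "r - s = r + - s" by transfer (rule eq, simp)
  show "c *\<^sub>C (r + s) = c *\<^sub>C r + c *\<^sub>C s"
    by transfer (rule eq, rule scaleC_add_right)
  show "(c + d) *\<^sub>C r = c *\<^sub>C r + d *\<^sub>C r"
    by transfer (rule eq, rule scaleC_add_left)
  show "c *\<^sub>C d *\<^sub>C r = (c * d) *\<^sub>C r" by transfer (rule eq, rule scaleC_scaleC)
  show "1 *\<^sub>C r = r" by transfer (rule eq, rule scaleC_one)
qed

end

lift_definition pure_tensor ::
    "'a::complex_vector \<Rightarrow> 'b::complex_vector \<Rightarrow> ('a, 'b) tensor"  (infixr \<open>\<otimes>\<^sub>t\<close> 70)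
  is free_pair .

text \<open>The linear map on the tensor product induced by a map \<open>B\<close>; the choice of representatives
  is irrelevant when \<open>B\<close> is bilinear.\<close>

definition tensor_lift ::
  "('a::complex_vector \<Rightarrow> 'b::complex_vector \<Rightarrow> 'c::complex_vector) \<Rightarrow> ('a, 'b) tensor \<Rightarrow> 'c"
  where "tensor_lift B t = free_lift (\<lambda>(x, y). B x y) (rep_tensor t)"

lemma tensor_lift_abs:
  assumes "cbilinear B"
  shows "tensor_lift B (abs_tensor p) = free_lift (\<lambda>(x, y). B x y) p"
proof -
  let ?f = "free_lift (\<lambda>(x, y). B x y)"
  interpret L: Vector_Spaces.linear scaleC scaleC ?f by (rule clinear_free_lift)
  have zero: "?f r = 0" if "r \<in> cvs.span tensor_relators" for r
    using that
  proof (induction rule: cvs.span_induct)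
    case base
    show ?case
      by (auto intro!: cvs.subspaceI simp: L.zero L.add L.scale)
  next
    case (step r)
    then show ?case
      using assms unfolding tensor_relators_def cbilinear_def clinear_iff
      by (auto simp: L.diff L.scale)
  qed
  have "tensor_eq (rep_tensor (abs_tensor p)) p"
    by (rule Quotient3_rep_abs[OF Quotient3_tensor])
       (simp add: tensor_eq_def cvs.span_zero)
  then have "?f (rep_tensor (abs_tensor p) - p) = 0"
    by (intro zero) (simp add: tensor_eq_def)
  then show ?thesis by (simp add: tensor_lift_def L.diff)
qed

lemma tensor_lift_pure:
  assumes "cbilinear B"
  shows "tensor_lift B (x \<otimes>\<^sub>t y) = B x y"
  by (simp add: pure_tensor.abs_eq tensor_lift_abs[OF assms] scaleC_one)

lemma clinear_tensor_lift:
  assumes "cbilinear B"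
  shows "clinear (tensor_lift B)"
proof -
  interpret L: Vector_Spaces.linear scaleC scaleC "free_lift (\<lambda>(x, y). B x y)"
    by (rule clinear_free_lift)
  have "tensor_lift B (s + t) = tensor_lift B s + tensor_lift B t" for s t
    by (induction s; induction t)
       (simp add: plus_tensor.abs_eq tensor_lift_abs[OF assms] L.add)
  moreover have "tensor_lift B (c *\<^sub>C t) = c *\<^sub>C tensor_lift B t" for c t
    by (induction t) (simp add: scaleC_tensor.abs_eq tensor_lift_abs[OF assms] L.scale)
  ultimately show ?thesis by (simp add: clinear_iff)
qed

lemma pure_tensor_bilinear:
  fixes x x' :: "'a::complex_vector" and y y' :: "'b::complex_vector"
  shows "(x + x') \<otimes>\<^sub>t y = x \<otimes>\<^sub>t y + x' \<otimes>\<^sub>t y"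
    and "x \<otimes>\<^sub>t (y + y') = x \<otimes>\<^sub>t y + x \<otimes>\<^sub>t y'"
    and "(c *\<^sub>C x) \<otimes>\<^sub>t y = c *\<^sub>C (x \<otimes>\<^sub>t y)"
    and "x \<otimes>\<^sub>t (c *\<^sub>C y) = c *\<^sub>C (x \<otimes>\<^sub>t y)"
proof -
  have "free_pair (x + x') y - free_pair x y - free_pair x' y \<in> tensor_relators"
    "free_pair x (y + y') - free_pair x y - free_pair x y' \<in> tensor_relators"
    "free_pair (c *\<^sub>C x) y - c *\<^sub>C free_pair x y \<in> tensor_relators"
    "free_pair x (c *\<^sub>C y) - c *\<^sub>C free_pair x y \<in> tensor_relators"
    unfolding tensor_relators_def Un_iff mem_Collect_eq by metis+
  then have "tensor_eq (free_pair (x + x') y) (free_pair x y + free_pair x' y)"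
    "tensor_eq (free_pair x (y + y')) (free_pair x y + free_pair x y')"
    "tensor_eq (free_pair (c *\<^sub>C x) y) (c *\<^sub>C free_pair x y)"
    "tensor_eq (free_pair x (c *\<^sub>C y)) (c *\<^sub>C free_pair x y)"
    by (simp_all add: tensor_eq_def cvs.span_base diff_diff_eq)
  then show "(x + x') \<otimes>\<^sub>t y = x \<otimes>\<^sub>t y + x' \<otimes>\<^sub>t y"
    and "x \<otimes>\<^sub>t (y + y') = x \<otimes>\<^sub>t y + x \<otimes>\<^sub>t y'"
    and "(c *\<^sub>C x) \<otimes>\<^sub>t y = c *\<^sub>C (x \<otimes>\<^sub>t y)"
    and "x \<otimes>\<^sub>t (c *\<^sub>C y) = c *\<^sub>C (x \<otimes>\<^sub>t y)"
    by (simp_all only: pure_tensor.abs_eq plus_tensor.abs_eq scaleC_tensor.abs_eq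
        tensor.abs_eq_iff)
qed

lemma cbilinear_pure_tensor: "cbilinear pure_tensor"
  by (simp add: cbilinear_def clinear_iff pure_tensor_bilinear)

text \<open>\<open>f \<otimes> g\<close> for linear maps \<open>f\<close>, \<open>g\<close>.\<close>

definition tensor_map ::
  "('a::complex_vector \<Rightarrow> 'c::complex_vector) \<Rightarrow> ('b::complex_vector \<Rightarrow> 'd::complex_vector) \<Rightarrow>
   ('a, 'b) tensor \<Rightarrow> ('c, 'd) tensor" where
  "tensor_map f g = tensor_lift (\<lambda>x y. f x \<otimes>\<^sub>t g y)"

definition tensor_swap ::
  "('a::complex_vector, 'b::complex_vector) tensor \<Rightarrow> ('b, 'a) tensor" where
  "tensor_swap = tensor_lift (\<lambda>x y. y \<otimes>\<^sub>t x)"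

lemma tensor_map_pure:
  assumes "clinear f" "clinear g"
  shows "tensor_map f g (x \<otimes>\<^sub>t y) = f x \<otimes>\<^sub>t g y"
proof -
  have "cbilinear (\<lambda>x y. f x \<otimes>\<^sub>t g y)"
    using assms by (simp add: cbilinear_def clinear_iff pure_tensor_bilinear)
  then show ?thesis by (simp add: tensor_map_def tensor_lift_pure)
qed

lemma tensor_swap_pure:
  fixes x :: "'a::complex_vector" and y :: "'b::complex_vector"
  shows "tensor_swap (x \<otimes>\<^sub>t y) = y \<otimes>\<^sub>t x"
proof -
  have "cbilinear (\<lambda>(x::'a) (y::'b). y \<otimes>\<^sub>t x)"
    by (simp add: cbilinear_def clinear_iff pure_tensor_bilinear)
  then show ?thesis by (simp add: tensor_swap_def tensor_lift_pure)
qed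

section \<open>The Casimir element\<close>

definition nondegenerate_symmetric_form :: "('h::complex_vector \<Rightarrow> 'h \<Rightarrow> complex) \<Rightarrow> bool" where
  "nondegenerate_symmetric_form form \<longleftrightarrow>
     cbilinear form \<and> (\<forall>x y. form x y = form y x) \<and> (\<forall>x. (\<forall>y. form x y = 0) \<longrightarrow> x = 0)"

definition orthonormal_basis ::
  "('h::complex_vector \<Rightarrow> 'h \<Rightarrow> complex) \<Rightarrow> 'h set \<Rightarrow> bool" where
  "orthonormal_basis form U \<longleftrightarrow>
     cvs.independent U \<and> cvs.span U = UNIV \<and>
     (\<forall>u\<in>U. \<forall>v\<in>U. form u v = (if u = v then 1 else 0))"

lemma orthonormal_basis_exists:
  fixes form :: "'h::complex_vector \<Rightarrow> 'h \<Rightarrow> complex"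
  assumes fin: "\<exists>B::'h set. finite B \<and> cvs.span B = UNIV"
    and nd: "nondegenerate_symmetric_form form"
  shows "\<exists>U. orthonormal_basis form U"
proof -
  obtain B :: "'h set" where B: "finite B" "cvs.span B = UNIV" using fin by blast
  have sym: "form x y = form y x" for x y
    using nd by (simp add: nondegenerate_symmetric_form_def)
  have bil: "cbilinear form" using nd by (simp add: nondegenerate_symmetric_form_def)
  have addl: "form (x + y) z = form x z + form y z"
    and scl: "form (c *\<^sub>C x) z = c * form x z" for x y z c
    using bil by (simp_all add: cbilinear_def clinear_iff scaleC_complex_def)
  have addr: "form z (x + y) = form z x + form z y"
    and scr: "form z (c *\<^sub>C x) = c * form z x" for x y z c
    using bil by (simp_all add: cbilinear_def clinear_iff scaleC_complex_def)
  have zl: "form 0 z = 0" for z using scl[of 0 0 z] by simp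
  have suml: "form (sum f S) z = (\<Sum>x\<in>S. form (f x) z)" for f S z
    by (induction S rule: infinite_finite_induct) (simp_all add: zl addl)
  have diffl: "form (x - y) z = form x z - form y z" for x y z
    using addl[of "x - y" y z] by simp
  define on where "on U \<longleftrightarrow> finite U \<and> (\<forall>u\<in>U. \<forall>v\<in>U. form u v = (if u = v then 1 else 0))"
    for U
  have coef: "form (\<Sum>v\<in>U. c v *\<^sub>C v) u = c u" if "on U" "u \<in> U" for U c u
  proof -
    have "form (\<Sum>v\<in>U. c v *\<^sub>C v) u = (\<Sum>v\<in>U. if v = u then c v else 0)"
      unfolding suml scl using that by (intro sum.cong) (auto simp: on_def)
    also have "\<dots> = c u" using that by (simp add: on_def)
    finally show ?thesis .
  qed
  have indep: "cvs.independent U" if "on U" for U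
  proof (rule cvs.independent_if_scalars_zero)
    show "finite U" using that by (simp add: on_def)
    show "c u = 0" if "(\<Sum>v\<in>U. c v *\<^sub>C v) = 0" "u \<in> U" for c u
      using coef[OF \<open>on U\<close> that(2), of c] that(1) zl by simp
  qed
  have bound: "card U \<le> card B" if "on U" for U
    using cvs.independent_span_bound[OF B(1) indep[OF that]] B(2) by simp
  have "on {}" by (simp add: on_def)
  then obtain U where U: "on U" "\<And>V. on V \<Longrightarrow> card V \<le> card U"
    using ex_has_greatest_nat[of on "{}" card "Suc (card B)"] bound less_Suc_eq_le by blast
  have finU: "finite U" using U(1) by (simp add: on_def)
  define proj where "proj v = (\<Sum>u\<in>U. form v u *\<^sub>C u)" for v
  have proj: "form (v - proj v) u = 0" if "u \<in> U" for u v
    using coef[OF U(1) that, of "form v"] by (simp add: diffl proj_def)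
  have iso: "form w w = 0" if w: "\<forall>u\<in>U. form w u = 0" for w
  proof (rule ccontr)
    assume ne: "form w w \<noteq> 0"
    let ?e = "(1 / csqrt (form w w)) *\<^sub>C w"
    have e1: "form ?e ?e = 1"
      using ne by (simp add: scl scr flip: power2_eq_square)
    have eu: "form ?e u = 0" if "u \<in> U" for u using w that by (simp add: scl)
    have "?e \<notin> U" using e1 eu by force
    moreover have "on (insert ?e U)"
      using U(1) e1 eu sym by (auto simp: on_def)
    ultimately show False using U(2)[of "insert ?e U"] finU by simp
  qed
  have orth: "w = 0" if w: "\<forall>u\<in>U. form w u = 0" for w
  proof -
    have "form w v = 0" for v
    proof -
      let ?v = "v - proj v"
      have v0: "\<forall>u\<in>U. form ?v u = 0" using proj by blast
      have "form (w + ?v) (w + ?v) = 0" using w v0 by (intro iso) (simp add: addl)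
      then have "2 * form w ?v = 0"
        using iso[OF w] iso[OF v0] sym[of ?v w] by (simp add: addl addr)
      moreover have "form w (proj v) = 0"
        unfolding proj_def sym[of w] suml scl using w sym by simp
      ultimately show ?thesis using addr[of w ?v "proj v"] by simp
    qed
    then show ?thesis using nd by (simp add: nondegenerate_symmetric_form_def)
  qed
  have "v = proj v" for v using orth[of "v - proj v"] proj by simp
  moreover have "proj v \<in> cvs.span U" for v
    unfolding proj_def by (intro cvs.span_sum cvs.span_scale cvs.span_base)
  ultimately have "cvs.span U = UNIV" by (metis UNIV_eq_I)
  then show ?thesis
    using U(1) indep[OF U(1)] by (auto simp: orthonormal_basis_def on_def)
qed

text \<open>\<open>casimir form\<close> does not depend on which orthonormal basis is chosen.\<close>

definition casimir :: "('h::complex_vector \<Rightarrow> 'h \<Rightarrow> complex) \<Rightarrow> ('h, 'h) tensor" where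
  "casimir form = (\<Sum>u\<in>(SOME U. orthonormal_basis form U). u \<otimes>\<^sub>t u)"

section \<open>Modules over an abelian Lie algebra\<close>

text \<open>The type \<open>'h\<close> carries the zero bracket, so a representation is a linear family of pairwise
  commuting linear operators.\<close>

definition h_module :: "('h::complex_vector \<Rightarrow> 'm::complex_vector \<Rightarrow> 'm) \<Rightarrow> bool" where
  "h_module \<rho> \<longleftrightarrow> cbilinear \<rho> \<and> (\<forall>x y v. \<rho> x (\<rho> y v) = \<rho> y (\<rho> x v))"

definition poly_op :: "complex poly \<Rightarrow> ('m::complex_vector \<Rightarrow> 'm) \<Rightarrow> 'm \<Rightarrow> 'm" where
  "poly_op f T v = (\<Sum>i\<le>degree f. coeff f i *\<^sub>C (T ^^ i) v)"

definition locally_finite :: "('h::complex_vector \<Rightarrow> 'm::complex_vector \<Rightarrow> 'm) \<Rightarrow> bool" where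
  "locally_finite \<rho> \<longleftrightarrow> (\<forall>x v. \<exists>f. f \<noteq> 0 \<and> poly_op f (\<rho> x) v = 0)"

definition h_morphism ::
  "('h::complex_vector \<Rightarrow> 'm::complex_vector \<Rightarrow> 'm) \<Rightarrow> ('h \<Rightarrow> 'n::complex_vector \<Rightarrow> 'n) \<Rightarrow>
   ('m \<Rightarrow> 'n) \<Rightarrow> bool" where
  "h_morphism \<rho> \<sigma> f \<longleftrightarrow> clinear f \<and> (\<forall>z v. f (\<rho> z v) = \<sigma> z (f v))"

definition tensor_action ::
  "('h::complex_vector \<Rightarrow> 'm::complex_vector \<Rightarrow> 'm) \<Rightarrow> ('h \<Rightarrow> 'n::complex_vector \<Rightarrow> 'n) \<Rightarrow>
   'h \<Rightarrow> ('m, 'n) tensor \<Rightarrow> ('m, 'n) tensor" where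
  "tensor_action \<rho> \<sigma> z t = tensor_map (\<rho> z) id t + tensor_map id (\<sigma> z) t"

definition trivial_action :: "'h::complex_vector \<Rightarrow> complex \<Rightarrow> complex" where
  "trivial_action z c = 0"

definition casimir_op ::
  "('h::complex_vector \<Rightarrow> 'h \<Rightarrow> complex) \<Rightarrow>
   ('h \<Rightarrow> 'm::complex_vector \<Rightarrow> 'm) \<Rightarrow> ('h \<Rightarrow> 'n::complex_vector \<Rightarrow> 'n) \<Rightarrow>
   ('m, 'n) tensor \<Rightarrow> ('m, 'n) tensor" where
  "casimir_op form \<rho> \<sigma> t = tensor_lift (\<lambda>x y. tensor_map (\<rho> x) (\<sigma> y) t) (casimir form)"

text \<open>The exponential of a locally finite operator. The vectors \<open>T\<^sup>n v\<close> span a finite-dimensional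
  space, in which the exponential series converges; since linear functionals extend from that
  subspace and separate points, its sum is the vector characterised by the convergence of the
  series under every linear functional. No topology on the whole space is involved.\<close>

definition lf_exp :: "('v::complex_vector \<Rightarrow> 'v) \<Rightarrow> 'v \<Rightarrow> 'v" where
  "lf_exp T v =
     (THE w. \<forall>\<phi> :: 'v \<Rightarrow> complex. clinear \<phi> \<longrightarrow> (\<lambda>n. \<phi> ((T ^^ n) v) / fact n) sums \<phi> w)"

lemma functionals_separate:
  fixes v w :: "'v::complex_vector"
  assumes "\<And>\<phi> :: 'v \<Rightarrow> complex. clinear \<phi> \<Longrightarrow> \<phi> v = \<phi> w"
  shows "v = w"
proof (rule ccontr)
  assume "v \<noteq> w"
  interpret P: vector_space_pair "scaleC :: complex \<Rightarrow> 'v \<Rightarrow> 'v"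
    "scaleC :: complex \<Rightarrow> complex \<Rightarrow> complex"
    by (simp add: vector_space_pair_def cvs.vector_space_axioms)
  have "cvs.independent {v - w}" using \<open>v \<noteq> w\<close> by simp
  then obtain \<phi> :: "'v \<Rightarrow> complex" where \<phi>: "clinear \<phi>" "\<phi> (v - w) = 1"
    using P.linear_independent_extend[of "{v - w}" "\<lambda>_. 1"] by auto
  interpret L: Vector_Spaces.linear scaleC scaleC \<phi> by (rule \<phi>(1))
  show False using \<phi>(2) assms[OF \<phi>(1)] by (simp add: L.diff)
qed

lemma lf_exp_eqI:
  fixes T :: "'v::complex_vector \<Rightarrow> 'v"
  assumes "\<And>\<phi> :: 'v \<Rightarrow> complex. clinear \<phi> \<Longrightarrow> (\<lambda>n. \<phi> ((T ^^ n) v) / fact n) sums \<phi> w"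
  shows "lf_exp T v = w"
  unfolding lf_exp_def
proof (rule the_equality)
  show "\<forall>\<phi> :: 'v \<Rightarrow> complex. clinear \<phi> \<longrightarrow> (\<lambda>n. \<phi> ((T ^^ n) v) / fact n) sums \<phi> w"
    using assms by blast
  fix w'
  assume w': "\<forall>\<phi> :: 'v \<Rightarrow> complex. clinear \<phi> \<longrightarrow>
    (\<lambda>n. \<phi> ((T ^^ n) v) / fact n) sums \<phi> w'"
  show "w' = w"
  proof (rule functionals_separate)
    fix \<phi> :: "'v \<Rightarrow> complex"
    assume \<phi>: "clinear \<phi>"
    show "\<phi> w' = \<phi> w"
      using w'[rule_format, OF \<phi>] assms[OF \<phi>] by (rule sums_unique2)
  qed
qed

lemma lf_exp_eigenvector:
  fixes T :: "'v::complex_vector \<Rightarrow> 'v"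
  assumes "clinear T" "T v = c *\<^sub>C v"
  shows "lf_exp T v = exp c *\<^sub>C v"
proof (rule lf_exp_eqI)
  fix \<phi> :: "'v \<Rightarrow> complex"
  assume \<phi>: "clinear \<phi>"
  have "(T ^^ n) v = c ^ n *\<^sub>C v" for n
    using assms by (induction n) (simp_all add: clinear_iff scaleC_one mult.commute)
  then have "\<phi> ((T ^^ n) v) / fact n = (c ^ n /\<^sub>R fact n) * \<phi> v" for n
    using \<phi> by (simp add: clinear_iff scaleC_complex_def scaleR_conv_of_real field_simps)
  moreover have "(\<lambda>n. (c ^ n /\<^sub>R fact n) * \<phi> v) sums (exp c * \<phi> v)"
    by (intro sums_mult2 exp_converges)
  ultimately show "(\<lambda>n. \<phi> ((T ^^ n) v) / fact n) sums \<phi> (exp c *\<^sub>C v)"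
    using \<phi> by (simp add: clinear_iff scaleC_complex_def)
qed

text \<open>\<open>c\<^sub>M\<^sub>,\<^sub>N(m \<otimes> n) = e\<^bsup>\<pi>i\<Omega>\<^esup>(n \<otimes> m)\<close>\<close>

definition braiding ::
  "('h::complex_vector \<Rightarrow> 'h \<Rightarrow> complex) \<Rightarrow>
   ('h \<Rightarrow> 'm::complex_vector \<Rightarrow> 'm) \<Rightarrow> ('h \<Rightarrow> 'n::complex_vector \<Rightarrow> 'n) \<Rightarrow>
   ('m, 'n) tensor \<Rightarrow> ('n, 'm) tensor" where
  "braiding form \<rho> \<sigma> t =
     lf_exp (\<lambda>s. (of_real pi * \<i>) *\<^sub>C casimir_op form \<sigma> \<rho> s) (tensor_swap t)"

lemma cbilinear_tensor_map:
  assumes "cbilinear \<rho>" "cbilinear \<sigma>"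
  shows "cbilinear (\<lambda>x y. tensor_map (\<rho> x) (\<sigma> y) t)"
proof -
  obtain p where t: "t = abs_tensor p" by (metis Quotient3_abs_rep[OF Quotient3_tensor])
  have bil: "cbilinear (\<lambda>a b. \<rho> x a \<otimes>\<^sub>t \<sigma> y b)" for x y
    using assms by (simp add: cbilinear_def clinear_iff pure_tensor_bilinear)
  have eq: "tensor_map (\<rho> x) (\<sigma> y) t =
      (\<Sum>q\<in>Poly_Mapping.keys p. Poly_Mapping.lookup p q *\<^sub>C (\<rho> x (fst q) \<otimes>\<^sub>t \<sigma> y (snd q)))" for x y
    unfolding t tensor_map_def tensor_lift_abs[OF bil]
    by (simp add: free_lift_def case_prod_beta)
  show ?thesis
    unfolding eq using assms
    by (simp add: cbilinear_def clinear_iff pure_tensor_bilinear scaleC_add_right sum.distrib cvs.scale_sum_right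
        mult.commute)
qed

lemma casimir_op_eq:
  assumes "h_module \<rho>" "h_module \<sigma>"
  shows "casimir_op form \<rho> \<sigma> t =
    (\<Sum>u\<in>(SOME U. orthonormal_basis form U). tensor_map (\<rho> u) (\<sigma> u) t)"
proof -
  have bil: "cbilinear (\<lambda>x y. tensor_map (\<rho> x) (\<sigma> y) t)"
    using assms by (simp add: h_module_def cbilinear_tensor_map)
  interpret L: Vector_Spaces.linear scaleC scaleC
      "tensor_lift (\<lambda>x y. tensor_map (\<rho> x) (\<sigma> y) t)"
    by (rule clinear_tensor_lift[OF bil])
  show ?thesis
    by (simp add: casimir_op_def casimir_def L.sum tensor_lift_pure[OF bil])
qed

lemma clinear_casimir_op:
  assumes "h_module \<rho>" "h_module \<sigma>"
  shows "clinear (casimir_op form \<rho> \<sigma>)"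
proof -
  have "clinear (tensor_map (\<rho> u) (\<sigma> u))" for u
    unfolding tensor_map_def using assms
    by (intro clinear_tensor_lift)
      (simp add: h_module_def cbilinear_def clinear_iff pure_tensor_bilinear)
  then show ?thesis
    by (simp add: clinear_iff casimir_op_eq[OF assms] sum.distrib cvs.scale_sum_right)
qed

text \<open>On weight vectors of weights \<open>(x, -)\<close> and \<open>(y, -)\<close> the braiding is \<open>e\<^bsup>\<pi>i(x,y)\<^esup>\<close> times
  the flip.\<close>

lemma braiding_weight_vectors:
  fixes form :: "'h::complex_vector \<Rightarrow> 'h \<Rightarrow> complex"
  assumes fin: "\<exists>B::'h set. finite B \<and> cvs.span B = UNIV"
    and nd: "nondegenerate_symmetric_form form"
    and mods: "h_module \<rho>" "h_module \<sigma>"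
    and m: "\<And>z. \<rho> z m = form x z *\<^sub>C m" and n: "\<And>z. \<sigma> z n = form y z *\<^sub>C n"
  shows "braiding form \<rho> \<sigma> (m \<otimes>\<^sub>t n) = exp (of_real pi * \<i> * form x y) *\<^sub>C (n \<otimes>\<^sub>t m)"
proof -
  define U where "U = (SOME U. orthonormal_basis form U)"
  have U: "orthonormal_basis form U"
    unfolding U_def using orthonormal_basis_exists[OF fin nd] by (rule someI_ex)
  obtain B :: "'h set" where "finite B" "cvs.span B = UNIV" using fin by blast
  then have finU: "finite U"
    using U cvs.independent_span_bound[of B U] by (simp add: orthonormal_basis_def)
  have bil: "cbilinear form" using nd by (simp add: nondegenerate_symmetric_form_def)
  have lin: "clinear (form x)" for x using bil by (simp add: cbilinear_def)
  have linl: "clinear (\<lambda>x. form x z)" for z using bil by (simp add: cbilinear_def)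
  have form0: "form 0 z = 0" for z
    using linl[of z] unfolding clinear_iff by (metis add_cancel_right_right)
  define g where "g y = (\<Sum>u\<in>U. form y u * form x u)" for y
  have "form y x = g y"
  proof -
    have "y \<in> cvs.span U" using U by (simp add: orthonormal_basis_def)
    then have "form y x = g y"
    proof (induction rule: cvs.span_induct)
      case base
      show ?case
        using linl unfolding g_def clinear_iff
        by (intro cvs.subspaceI)
          (auto simp: scaleC_complex_def distrib_right sum.distrib mult.assoc
            form0 simp flip: sum_distrib_left)
    next
      case (step v)
      have "g v = (\<Sum>u\<in>U. if u = v then form x u else 0)"
        unfolding g_def using U step by (intro sum.cong) (auto simp: orthonormal_basis_def)
      then show ?case
        using step finU nd by (simp add: nondegenerate_symmetric_form_def)
    qed
    then show ?thesis by simp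
  qed
  have lins: "clinear (\<rho> u)" "clinear (\<sigma> u)" for u
    using mods by (simp_all add: h_module_def cbilinear_def)
  have "casimir_op form \<sigma> \<rho> (n \<otimes>\<^sub>t m) = (\<Sum>u\<in>U. (form y u *\<^sub>C n) \<otimes>\<^sub>t (form x u *\<^sub>C m))"
    by (simp add: casimir_op_eq mods tensor_map_pure lins m n U_def)
  also have "\<dots> = form x y *\<^sub>C (n \<otimes>\<^sub>t m)"
    using \<open>form y x = g y\<close> nd
    by (simp add: pure_tensor_bilinear scaleC_scaleC g_def mult.commute cvs.scale_sum_left nondegenerate_symmetric_form_def)
  finally have ev: "(of_real pi * \<i>) *\<^sub>C casimir_op form \<sigma> \<rho> (n \<otimes>\<^sub>t m) =
      (of_real pi * \<i> * form x y) *\<^sub>C (n \<otimes>\<^sub>t m)"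
    by (simp add: scaleC_scaleC)
  show ?thesis
    unfolding braiding_def tensor_swap_pure
  proof (rule lf_exp_eigenvector)
    show "clinear (\<lambda>s. (of_real pi * \<i>) *\<^sub>C casimir_op form \<sigma> \<rho> s)"
      using clinear_casimir_op[OF mods(2,1), of form]
      by (simp add: clinear_iff scaleC_add_right cvs.scale_left_commute)
  qed (fact ev)
qed

section \<open>Algebras in the braided category\<close>

definition h_algebra :: "('h::complex_vector \<Rightarrow> 'a::complex_algebra_1 \<Rightarrow> 'a) \<Rightarrow> bool" where
  "h_algebra \<rho> \<longleftrightarrow>
     h_module \<rho> \<and> locally_finite \<rho> \<and> (\<forall>z a b. \<rho> z (a * b) = \<rho> z a * b + a * \<rho> z b)"

definition mult_map :: "('a::complex_algebra_1, 'a) tensor \<Rightarrow> 'a" where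
  "mult_map = tensor_lift (*)"

definition braided_commutative ::
  "('h::complex_vector \<Rightarrow> 'h \<Rightarrow> complex) \<Rightarrow> ('h \<Rightarrow> 'a::complex_algebra_1 \<Rightarrow> 'a) \<Rightarrow> bool" where
  "braided_commutative form \<rho> \<longleftrightarrow> (\<forall>a b. mult_map (braiding form \<rho> \<rho> (a \<otimes>\<^sub>t b)) = a * b)"

definition h_invariants :: "('h::complex_vector \<Rightarrow> 'a::complex_vector \<Rightarrow> 'a) \<Rightarrow> 'a set" where
  "h_invariants \<rho> = {a. \<forall>z. \<rho> z a = 0}"

text \<open>Bilinear forms \<open>\<beta> : A \<otimes> A \<rightarrow> k\<close> are linear functionals on \<open>A \<otimes> A\<close>. Such a form lies in the
  category if it is a morphism to the trivial module, that is, if \<open>\<beta>(za,b) + \<beta>(a,zb) = 0\<close>.\<close>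

definition multiplicative_form :: "(('a::complex_algebra_1, 'a) tensor \<Rightarrow> complex) \<Rightarrow> bool" where
  "multiplicative_form \<beta> \<longleftrightarrow> (\<forall>a b c. \<beta> ((a * b) \<otimes>\<^sub>t c) = \<beta> (a \<otimes>\<^sub>t (b * c)))"

definition nondegenerate_form :: "(('a::complex_vector, 'a) tensor \<Rightarrow> complex) \<Rightarrow> bool" where
  "nondegenerate_form \<beta> \<longleftrightarrow>
     (\<forall>a. (\<forall>b. \<beta> (a \<otimes>\<^sub>t b) = 0) \<longrightarrow> a = 0) \<and> (\<forall>b. (\<forall>a. \<beta> (a \<otimes>\<^sub>t b) = 0) \<longrightarrow> b = 0)"

text \<open>An algebra with \<open>'h\<close>-action on a linear subspace of an ambient space, with addition and
  scalar multiplication inherited from the latter. This is needed since the underlying space of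
  \<open>k[L,\<alpha>]\<close> depends on the subgroup \<open>L\<close>, hence is not a type.\<close>

record ('h, 'a) halg =
  alg_carrier :: "'a set"
  alg_mult :: "'a \<Rightarrow> 'a \<Rightarrow> 'a"
  alg_one :: 'a
  alg_act :: "'h \<Rightarrow> 'a \<Rightarrow> 'a"

definition halg_iso ::
  "('h, 'a::complex_vector) halg \<Rightarrow> ('h, 'b::complex_vector) halg \<Rightarrow> bool"  (infix \<open>\<cong>\<^sub>h\<close> 50) where
  "A \<cong>\<^sub>h B \<longleftrightarrow>
     (\<exists>f. bij_betw f (alg_carrier A) (alg_carrier B) \<and>
       (\<forall>a\<in>alg_carrier A. \<forall>b\<in>alg_carrier A. f (a + b) = f a + f b) \<and>
       (\<forall>c. \<forall>a\<in>alg_carrier A. f (c *\<^sub>C a) = c *\<^sub>C f a) \<and>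
       (\<forall>a\<in>alg_carrier A. \<forall>b\<in>alg_carrier A. f (alg_mult A a b) = alg_mult B (f a) (f b)) \<and>
       f (alg_one A) = alg_one B \<and>
       (\<forall>z. \<forall>a\<in>alg_carrier A. f (alg_act A z a) = alg_act B z (f a)))"

definition full_halg :: "('h \<Rightarrow> 'a::complex_algebra_1 \<Rightarrow> 'a) \<Rightarrow> ('h, 'a) halg" where
  "full_halg \<rho> = \<lparr>alg_carrier = UNIV, alg_mult = (*), alg_one = 1, alg_act = \<rho>\<rparr>"

section \<open>Skew group algebras\<close>

definition add_subgroup :: "'h::ab_group_add set \<Rightarrow> bool" where
  "add_subgroup L \<longleftrightarrow> 0 \<in> L \<and> (\<forall>x\<in>L. \<forall>y\<in>L. x + y \<in> L) \<and> (\<forall>x\<in>L. - x \<in> L)"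

definition integral_even_on :: "('h \<Rightarrow> 'h \<Rightarrow> complex) \<Rightarrow> 'h set \<Rightarrow> bool" where
  "integral_even_on form L \<longleftrightarrow>
     (\<forall>x\<in>L. \<forall>y\<in>L. form x y \<in> \<int>) \<and> (\<forall>x\<in>L. \<exists>n::int. form x x = 2 * of_int n)"

text \<open>Cocycles on \<open>L\<close> with values in \<open>k\<^sup>\<times>\<close>; values off \<open>L \<times> L\<close> are irrelevant.\<close>

definition normalised_cocycle :: "'h::ab_group_add set \<Rightarrow> ('h \<Rightarrow> 'h \<Rightarrow> complex) \<Rightarrow> bool" where
  "normalised_cocycle L \<alpha> \<longleftrightarrow>
     (\<forall>x\<in>L. \<forall>y\<in>L. \<alpha> x y \<noteq> 0) \<and>
     (\<forall>x\<in>L. \<forall>y\<in>L. \<forall>z\<in>L. \<alpha> y z * \<alpha> x (y + z) = \<alpha> (x + y) z * \<alpha> x y) \<and>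
     (\<forall>x\<in>L. \<alpha> x 0 = 1 \<and> \<alpha> 0 x = 1)"

definition cohomologous ::
  "'h::ab_group_add set \<Rightarrow> ('h \<Rightarrow> 'h \<Rightarrow> complex) \<Rightarrow> ('h \<Rightarrow> 'h \<Rightarrow> complex) \<Rightarrow> bool" where
  "cohomologous L \<alpha> \<alpha>' \<longleftrightarrow>
     (\<exists>\<gamma>. (\<forall>x\<in>L. \<gamma> x \<noteq> 0) \<and>
          (\<forall>x\<in>L. \<forall>y\<in>L. \<alpha>' x y = \<alpha> x y * (\<gamma> y * \<gamma> x / \<gamma> (x + y))))"

definition commutator_condition ::
  "('h \<Rightarrow> 'h \<Rightarrow> complex) \<Rightarrow> 'h set \<Rightarrow> ('h \<Rightarrow> 'h \<Rightarrow> complex) \<Rightarrow> bool" where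
  "commutator_condition form L \<alpha> \<longleftrightarrow>
     (\<forall>x\<in>L. \<forall>y\<in>L. \<alpha> x y / \<alpha> y x = exp (of_real pi * \<i> * form x y))"

text \<open>\<open>k[L,\<alpha>]\<close> is realised on the functions on \<open>L\<close> of finite support, with
  \<open>e\<^sub>x = Poly_Mapping.single x 1\<close>.\<close>

definition skew_group_algebra ::
  "('h::complex_vector \<Rightarrow> 'h \<Rightarrow> complex) \<Rightarrow> 'h set \<Rightarrow> ('h \<Rightarrow> 'h \<Rightarrow> complex) \<Rightarrow>
   ('h, 'h \<Rightarrow>\<^sub>0 complex) halg" where
  "skew_group_algebra form L \<alpha> =
     \<lparr>alg_carrier = {f. Poly_Mapping.keys f \<subseteq> L},
      alg_mult = (\<lambda>f g. \<Sum>x\<in>Poly_Mapping.keys f. \<Sum>y\<in>Poly_Mapping.keys g.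
                    Poly_Mapping.single (x + y)
                      (Poly_Mapping.lookup f x * Poly_Mapping.lookup g y * \<alpha> x y)),
      alg_one = Poly_Mapping.single 0 1,
      alg_act = (\<lambda>z f. \<Sum>x\<in>Poly_Mapping.keys f.
                   Poly_Mapping.single x (form x z * Poly_Mapping.lookup f x))\<rparr>"

lemma scaleC_single: "c *\<^sub>C Poly_Mapping.single x d = Poly_Mapping.single x (c * d)"
  for c d :: complex
  by (rule poly_mapping_eqI) (simp add: scaleC_complex_def lookup_single when_def)

lemma skew_group_algebra_basis:
  "alg_mult (skew_group_algebra form L \<alpha>) (Poly_Mapping.single x 1) (Poly_Mapping.single y 1) =
     \<alpha> x y *\<^sub>C Poly_Mapping.single (x + y) 1"
  "alg_act (skew_group_algebra form L \<alpha>) z (Poly_Mapping.single x 1) =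
     form x z *\<^sub>C Poly_Mapping.single x 1"
  by (simp_all add: skew_group_algebra_def scaleC_single)

end

theory Submission
  imports
    Defs
    "HOL-Algebra.Generated_Groups"
    "HOL-Computational_Algebra.Fundamental_Theorem_Algebra"
begin

text \<open>
  A multiplicative form is \<open>\<beta>(a, b) = tr (ab)\<close> for the trace \<open>tr a = \<beta>(a, 1)\<close>, which vanishes
  on \<open>za\<close> for all \<open>z \<in> h\<close>. Local finiteness decomposes \<open>A\<close> into joint generalised weight spaces
  \<open>A\<^sub>\<chi>\<close>. If \<open>A\<^sub>0\<close> were larger than \<open>A\<^sup>h = k\<close>, there would be \<open>z\<close> and \<open>x\<close> with \<open>zx = 1\<close>; then
  \<open>z\<close> is surjective on \<open>A\<close>, so \<open>tr = 0\<close>, contradicting non-degeneracy. Hence \<open>A\<^sub>0 = k\<close>, and since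
  \<open>tr\<close> pairs \<open>A\<^sub>\<chi>\<close> with \<open>A\<^sub>-\<^sub>\<chi>\<close>, every nonzero element of \<open>A\<^sub>\<chi>\<close> is invertible with inverse in
  \<open>A\<^sub>-\<^sub>\<chi>\<close>. So \<open>A\<^sub>\<chi>\<close> is one-dimensional and consists of genuine weight vectors, and the weights
  form the subgroup \<open>L\<close>. Braided commutativity gives \<open>ab = e\<^bsup>\<pi>i(x,y)\<^esup> ba\<close> on weight vectors; taking
  \<open>a = b\<close> shows that \<open>(x, x)\<close> is even, and polarisation that \<open>(x, y)\<close> is an integer.

  Two cocycles with the same commutator differ by a symmetric cocycle \<open>\<delta>\<close>. The extension of \<open>L\<close> by
  \<open>k\<^sup>\<times>\<close> that \<open>\<delta>\<close> defines is abelian, hence splits because \<open>k\<^sup>\<times>\<close> is divisible, so \<open>\<delta>\<close> is a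
  coboundary.
\<close>

section \<open>Complements of divisible subgroups\<close>

text \<open>A maximal subgroup \<open>F\<close> meeting \<open>Z\<close> trivially works: by divisibility, any \<open>g\<close> can be
  multiplied by an element of \<open>Z\<close> so that all its powers in \<open>FZ\<close> lie in \<open>F\<close>, and then it can be
  adjoined to \<open>F\<close>.\<close>

lemma (in comm_group) divisible_subgroup_complement:
  assumes Z: "subgroup Z G"
    and div: "\<And>z n. z \<in> Z \<Longrightarrow> 0 < (n::nat) \<Longrightarrow> \<exists>w\<in>Z. w [^] n = z"
  shows "\<exists>F. subgroup F G \<and> F \<inter> Z = {\<one>} \<and> carrier G = F <#> Z"
proof -
  let ?A = "{F. subgroup F G \<and> F \<inter> Z = {\<one>}}"
  have "\<exists>F\<in>?A. \<forall>X\<in>?A. F \<subseteq> X \<longrightarrow> X = F"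
  proof (rule subset_Zorn_nonempty)
    show "?A \<noteq> {}"
      using triv_subgroup subgroup.one_closed[OF Z] by blast
    fix C assume "C \<noteq> {}" and C: "subset.chain ?A C"
    then have sub: "subgroup F G" "F \<inter> Z = {\<one>}" if "F \<in> C" for F
      using that by (auto simp: subset.chain_def)
    have "subgroup (\<Union>C) G"
    proof (rule subgroupI)
      show "\<Union>C \<subseteq> carrier G" using sub subgroup.subset by blast
      show "\<Union>C \<noteq> {}" using \<open>C \<noteq> {}\<close> sub subgroup.one_closed by blast
      show "inv a \<in> \<Union>C" if "a \<in> \<Union>C" for a
        using that sub(1) by (metis UnionE UnionI subgroup.m_inv_closed)
      fix a b assume "a \<in> \<Union>C" "b \<in> \<Union>C"
      then obtain F where "F \<in> C" "a \<in> F" "b \<in> F"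
        using C unfolding subset_chain_def by blast
      then show "a \<otimes> b \<in> \<Union>C" using sub(1) by (metis UnionI subgroup.m_closed)
    qed
    moreover have "\<Union>C \<inter> Z = {\<one>}" using \<open>C \<noteq> {}\<close> sub(2) by blast
    ultimately show "\<Union>C \<in> ?A" by simp
  qed
  then obtain F where F: "subgroup F G" "F \<inter> Z = {\<one>}"
    and max: "\<And>X. subgroup X G \<Longrightarrow> X \<inter> Z = {\<one>} \<Longrightarrow> F \<subseteq> X \<Longrightarrow> X = F"
    by auto
  define M where "M = F <#> Z"
  have M: "subgroup M G" unfolding M_def by (rule mult_subgroups[OF F(1) Z])
  have FM: "F \<subseteq> M"
  proof
    fix f assume "f \<in> F"
    then have "f = f \<otimes> \<one>" using F(1) by (simp add: subgroup.mem_carrier)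
    then show "f \<in> M"
      using \<open>f \<in> F\<close> subgroup.one_closed[OF Z] unfolding M_def set_mult_def by blast
  qed
  have ZM: "Z \<subseteq> M"
  proof
    fix z assume "z \<in> Z"
    then have "z = \<one> \<otimes> z" using Z by (simp add: subgroup.mem_carrier)
    then show "z \<in> M"
      using \<open>z \<in> Z\<close> subgroup.one_closed[OF F(1)] unfolding M_def set_mult_def by blast
  qed
  \<comment> \<open>Adjoining \<open>h\<close>: an element of \<open>Z\<close> of the form
    \<open>f \<otimes> h [^] n\<close> forces \<open>h [^] n\<close> into \<open>M = FZ\<close>,
    hence by \<open>P\<close> into \<open>F\<close>, so the element lies in
    \<open>F \<inter> Z\<close>. The enlarged subgroup thus still meets \<open>Z\<close> trivially,
    and maximality puts \<open>h\<close> into \<open>F\<close>.\<close>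
  have in_F: "h \<in> F" if h: "h \<in> carrier G"
    and P: "\<And>n::int. h [^] n \<in> M \<Longrightarrow> h [^] n \<in> F" for h
  proof -
    define H where "H = range (\<lambda>n::int. h [^] n)"
    have H: "subgroup H G"
      unfolding H_def
    proof (rule subgroupI)
      show "inv a \<in> range (\<lambda>n::int. h [^] n)" if "a \<in> range (\<lambda>n::int. h [^] n)" for a
        using that h int_pow_neg[OF h] by (metis (no_types, lifting) rangeE rangeI)
      show "a \<otimes> b \<in> range (\<lambda>n::int. h [^] n)"
        if "a \<in> range (\<lambda>n::int. h [^] n)" "b \<in> range (\<lambda>n::int. h [^] n)" for a b
        using that h int_pow_mult[OF h] by (metis (no_types, lifting) rangeE rangeI)
    qed (use h in auto)
    have "subgroup (F <#> H) G" by (rule mult_subgroups[OF F(1) H])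
    moreover have "F \<subseteq> F <#> H"
    proof
      fix f assume "f \<in> F"
      then have "f = f \<otimes> \<one>" using F(1) by (simp add: subgroup.mem_carrier)
      then show "f \<in> F <#> H"
        using \<open>f \<in> F\<close> subgroup.one_closed[OF H] unfolding set_mult_def by blast
    qed
    moreover have "(F <#> H) \<inter> Z = {\<one>}"
    proof
      show "{\<one>} \<subseteq> (F <#> H) \<inter> Z"
        using \<open>F \<subseteq> F <#> H\<close> F(1) Z by (auto simp: subgroup.one_closed)
      show "(F <#> H) \<inter> Z \<subseteq> {\<one>}"
      proof
        fix z assume "z \<in> (F <#> H) \<inter> Z"
        then obtain f n where f: "f \<in> F" "z = f \<otimes> h [^] (n::int)" "z \<in> Z"
          by (auto simp: set_mult_def H_def)
        have "h [^] n = inv f \<otimes> z"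
          using f h F(1) by (simp add: subgroup.mem_carrier inv_solve_left)
        moreover have "inv f \<otimes> z \<in> M"
          unfolding M_def set_mult_def using f subgroup.m_inv_closed[OF F(1)] by blast
        ultimately have "h [^] n \<in> F" using P by metis
        then have "z \<in> F" using f F(1) by (simp add: subgroup.m_closed)
        then show "z \<in> {\<one>}" using f F(2) by blast
      qed
    qed
    ultimately have "F <#> H = F" using max by blast
    moreover have "h \<in> F <#> H"
    proof -
      have "h = \<one> \<otimes> h [^] (1::int)" using h by (simp add: int_pow_1)
      then show ?thesis
        using subgroup.one_closed[OF F(1)] unfolding set_mult_def H_def by blast
    qed
    ultimately show ?thesis by simp
  qed
  have "g \<in> M" if g: "g \<in> carrier G" for g
  proof (cases "\<exists>n::nat. 0 < n \<and> g [^] n \<in> M")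
    case False
    \<comment> \<open>Here only the exponent 0 gives a power of \<open>g\<close> in
      \<open>M\<close>, so \<open>g\<close> itself can be adjoined.\<close>
    have "g [^] n \<in> F" if n: "g [^] n \<in> M" for n :: int
    proof -
      have "g [^] (nat \<bar>n\<bar>) \<in> M"
      proof (cases "n \<ge> 0")
        case True
        then show ?thesis using n g by (metis abs_of_nonneg int_nat_eq int_pow_int)
      next
        case neg: False
        then have "g [^] (nat \<bar>n\<bar>) = inv (g [^] n)"
          using int_pow_neg[OF g, of n] by (simp flip: int_pow_int)
        then show ?thesis using n M by (simp add: subgroup.m_inv_closed)
      qed
      then have "n = 0" using False by (metis zero_less_abs_iff zero_less_nat_eq)
      then show ?thesis using F(1) by (simp add: subgroup.one_closed)
    qed
    then show ?thesis using in_F[OF g] FM by blast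
  next
    case True
    define d where "d = (LEAST n::nat. 0 < n \<and> g [^] n \<in> M)"
    have d: "0 < d" "g [^] d \<in> M" using LeastI_ex[OF True] by (auto simp: d_def)
    have least: "d \<le> n" if "0 < n" "g [^] n \<in> M" for n
      unfolding d_def using that by (intro Least_le) simp
    obtain f z where fz: "f \<in> F" "z \<in> Z" "g [^] d = f \<otimes> z"
      using d(2) by (auto simp: M_def set_mult_def)
    obtain w where w: "w \<in> Z" "w [^] d = z" using div[OF fz(2) d(1)] by blast
    have wc: "w \<in> carrier G" using w Z by (simp add: subgroup.mem_carrier)
    have fc: "f \<in> carrier G" using fz F by (simp add: subgroup.mem_carrier)
    \<comment> \<open>Correcting \<open>g\<close> by a \<open>d\<close>-th root \<open>w\<close> of
      the \<open>Z\<close>-part of \<open>g [^] d\<close> leaves \<open>h [^] d = f\<close> in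
      \<open>F\<close>, without changing the coset modulo \<open>Z\<close>.\<close>
    define h where "h = g \<otimes> inv w"
    have h: "h \<in> carrier G" using g wc by (simp add: h_def)
    have gh: "g = h \<otimes> w" using g wc by (simp add: h_def m_assoc)
    have "h [^] d = g [^] d \<otimes> inv (w [^] d)"
      using g wc by (simp add: h_def nat_pow_distrib nat_pow_inv)
    then have hd: "h [^] d = f"
      using fz w fc wc by (metis m_assoc nat_pow_closed r_inv r_one inv_closed)
    have gM: "g [^] n \<in> M" if "h [^] n \<in> M" for n :: int
    proof -
      have "g [^] n = h [^] n \<otimes> w [^] n"
        unfolding gh by (rule int_pow_distrib[OF h wc])
      moreover have "w [^] n \<in> Z"
        by (rule subgroup_int_pow_closed[OF Z w(1)])
      ultimately show ?thesis using that ZM M by (auto simp: subgroup.m_closed)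
    qed
    have "h [^] n \<in> F" if n: "h [^] n \<in> M" for n :: int
    proof -
      have hdF: "h [^] (int d * k) \<in> F" for k
        using subgroup_int_pow_closed[OF F(1) fz(1), of k] int_pow_pow[OF h, of "int d" k]
        by (simp add: int_pow_int hd)
      \<comment> \<open>Division with remainder by \<open>d\<close>: the remainder power of
        \<open>h\<close> lies in \<open>M\<close>, hence so does that of \<open>g\<close>, and
        minimality of \<open>d\<close> makes the remainder 0. So \<open>h [^] n\<close> is a power
        of \<open>f\<close>.\<close>
      have split: "h [^] n = h [^] (int d * (n div int d)) \<otimes> h [^] (n mod int d)"
        using h by (simp flip: int_pow_mult)
      then have "h [^] (n mod int d) = inv (h [^] (int d * (n div int d))) \<otimes> h [^] n"
        using h by (simp add: inv_solve_left)
      moreover have "h [^] (int d * (n div int d)) \<in> M" using hdF FM by blast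
      ultimately have "h [^] (n mod int d) \<in> M"
        using n subgroup.m_closed[OF M subgroup.m_inv_closed[OF M]] by metis
      then have "g [^] (nat (n mod int d)) \<in> M"
        using gM[of "n mod int d"] d(1) by (simp flip: int_pow_int)
      moreover have "nat (n mod int d) < d" using d(1) by (simp add: nat_less_iff)
      ultimately have "nat (n mod int d) = 0" using least by (meson not_gr_zero not_le)
      then have "n mod int d = 0" using d(1) by (simp add: nat_eq_iff)
      then show ?thesis using split h hdF by simp
    qed
    then have "h \<in> F" using in_F[OF h] by blast
    then show ?thesis using w(1) gh unfolding M_def set_mult_def by blast
  qed
  then have "carrier G = F <#> Z" using M subgroup.subset unfolding M_def by blast
  then show ?thesis using F by blast
qed

section \<open>Locally finite operators\<close>

lemma poly_op_superset:
  "degree f \<le> n \<Longrightarrow> poly_op f T v = (\<Sum>i\<le>n. coeff f i *\<^sub>C (T ^^ i) v)"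
  unfolding poly_op_def by (intro sum.mono_neutral_left) (auto simp: coeff_eq_0)

lemma poly_op_add: "poly_op (p + q) T v = poly_op p T v + poly_op q T v"
proof -
  let ?n = "max (degree p) (degree q)"
  have "degree (p + q) \<le> ?n" by (rule degree_add_le_max)
  then show ?thesis
    by (simp add: poly_op_superset[of _ ?n] scaleC_add_left sum.distrib)
qed

lemma poly_op_smult: "poly_op (smult c p) T v = c *\<^sub>C poly_op p T v"
  by (simp add: poly_op_superset[of _ "degree p"] degree_smult_le cvs.scale_sum_right scaleC_scaleC)

lemma poly_op_0 [simp]: "poly_op 0 T v = 0"
  by (simp add: poly_op_def)

lemma poly_op_1 [simp]: "poly_op 1 T v = v"
  by (simp add: poly_op_def scaleC_one)

lemma clinear_0: "clinear f \<Longrightarrow> f 0 = 0"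
  unfolding clinear_iff by (metis add_cancel_right_right)

lemma clinear_diff: "clinear f \<Longrightarrow> f (x - y) = f x - f y"
  unfolding clinear_iff by (metis add_diff_cancel_right' diff_add_cancel)

lemma clinear_sum: "clinear f \<Longrightarrow> f (sum g S) = (\<Sum>x\<in>S. f (g x))"
  by (induction S rule: infinite_finite_induct) (simp_all add: clinear_0 clinear_iff)

lemma clinear_funpow:
  fixes T :: "'v::complex_vector \<Rightarrow> 'v"
  shows "clinear T \<Longrightarrow> clinear (T ^^ n)"
  by (induction n) (simp_all add: clinear_iff)

lemma poly_op_pCons: "poly_op (pCons a p) T v = a *\<^sub>C v + poly_op p T (T v)"
proof -
  have "degree (pCons a p) \<le> Suc (degree p)" by (rule degree_pCons_le)
  then have "poly_op (pCons a p) T v = (\<Sum>i\<le>Suc (degree p). coeff (pCons a p) i *\<^sub>C (T ^^ i) v)"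
    by (rule poly_op_superset)
  also have "\<dots> = a *\<^sub>C v + (\<Sum>i\<le>degree p. coeff p i *\<^sub>C (T ^^ i) (T v))"
    by (simp add: sum.atMost_Suc_shift funpow_swap1 del: sum.atMost_Suc)
  finally show ?thesis by (simp add: poly_op_def)
qed

lemma clinear_poly_op:
  assumes "clinear T"
  shows "clinear (poly_op p T)"
  using clinear_funpow[OF assms]
  by (simp add: clinear_iff poly_op_def scaleC_add_right sum.distrib cvs.scale_sum_right mult.commute)

lemma poly_op_commute:
  assumes S: "clinear S" and comm: "\<And>v. S (T v) = T (S v)"
  shows "S (poly_op p T v) = poly_op p T (S v)"
  using S
  by (induction p arbitrary: v) (simp_all add: clinear_0 poly_op_pCons clinear_iff comm)

lemma poly_op_mult:
  assumes T: "clinear T"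
  shows "poly_op (p * q) T v = poly_op p T (poly_op q T v)"
proof (induction p arbitrary: v)
  case (pCons a p)
  have "poly_op (pCons a p * q) T v = a *\<^sub>C poly_op q T v + poly_op (p * q) T (T v)"
    by (simp add: poly_op_add poly_op_smult poly_op_pCons)
  then show ?case
    using pCons poly_op_commute[OF T, of T q v] by (simp add: poly_op_pCons)
qed simp

lemma poly_op_linear_power:
  assumes T: "clinear T"
  shows "poly_op ([:- c, 1:] ^ n) T v = ((\<lambda>w. T w - c *\<^sub>C w) ^^ n) v"
proof (induction n)
  case (Suc n)
  have "poly_op [:- c, 1:] T w = T w - c *\<^sub>C w" for w
    by (simp add: poly_op_pCons scaleC_one)
  then show ?case using Suc by (simp add: poly_op_mult[OF T] del: mult_pCons_left)
qed simp

text \<open>An explicit Bezout identity. With \<open>k = 1 / q(c)\<close>, the polynomial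
  \<open>1 - k * q\<close> vanishes at \<open>c\<close>, so its \<open>n\<close>-th power is a
  multiple of \<open>(X - c)^n\<close>; the same power is congruent to 1 modulo
  \<open>q\<close>.\<close>

lemma coprime_linear_power:
  fixes q :: "complex poly"
  assumes "poly q c \<noteq> 0"
  obtains u w where "u * [:- c, 1:] ^ n + w * q = 1"
proof -
  define k where "k = [:1 / poly q c:]"
  have "poly (k * q - 1) c = 0" using assms by (simp add: k_def)
  then obtain r where r: "k * q - 1 = [:- c, 1:] * r"
    by (metis dvdE poly_eq_0_iff_dvd)
  have "(1 - k * q) - 1 dvd (1 - k * q) ^ n - 1"
    by (metis dvd_triv_left power_diff_1_eq)
  then obtain s where s: "(1 - k * q) ^ n - 1 = ((1 - k * q) - 1) * s" ..
  have "(1 - k * q) ^ n = (- r) ^ n * [:- c, 1:] ^ n"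
    by (metis minus_diff_eq mult.commute mult_minus_right power_mult_distrib r)
  then have "(- r) ^ n * [:- c, 1:] ^ n + (k * s) * q = 1"
    using s by (simp add: algebra_simps)
  then show thesis by (rule that)
qed

text \<open>Induction on the degree of the annihilating polynomial: split off the full power of one
  linear factor and use Bezout to write \<open>v = v1 + v2\<close>, where \<open>v2\<close> is a
  generalised eigenvector and \<open>v1\<close> is killed by the cofactor. The pieces are recorded
  as polynomials in \<open>T\<close> applied to \<open>v\<close>, so that they stay in every
  subspace stable under \<open>T\<close> that contains \<open>v\<close>.\<close>

lemma primary_decomposition:
  fixes T :: "'v::complex_vector \<Rightarrow> 'v"
  assumes T: "clinear T" and "f \<noteq> 0" "poly_op f T v = 0"
  shows "v \<in> cvs.span {w. \<exists>p c n. w = poly_op p T v \<and> ((\<lambda>x. T x - c *\<^sub>C x) ^^ n) w = 0}"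
    (is "_ \<in> cvs.span (?E v)")
  using assms(2,3)
proof (induction "degree f" arbitrary: f v rule: less_induct)
  case less
  show ?case
  proof (cases "degree f = 0")
    case True
    then obtain a where "f = [:a:]" by (rule degree_eq_zeroE)
    then have "v = 0" using less.prems by (simp add: poly_op_pCons)
    then show ?thesis by (simp add: cvs.span_zero)
  next
    case False
    then obtain c where c: "poly f c = 0"
      using fundamental_theorem_of_algebra constant_degree by metis
    define n where "n = Polynomial.order c f"
    obtain q where q: "f = [:- c, 1:] ^ n * q" "\<not> [:- c, 1:] dvd q"
      using order_decomp[OF less.prems(1)] n_def by blast
    have "0 < n" using c less.prems(1) by (simp add: n_def order_root)
    have "q \<noteq> 0" using less.prems(1) q(1) by auto
    then have deg: "degree q < degree f"
      using \<open>0 < n\<close> unfolding q(1) by (simp add: degree_mult_eq degree_linear_power)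
    obtain u w where uw: "u * [:- c, 1:] ^ n + w * q = 1"
      using coprime_linear_power[of q c] q(2) by (auto simp: poly_eq_0_iff_dvd)
    define v1 where "v1 = poly_op (u * [:- c, 1:] ^ n) T v"
    define v2 where "v2 = poly_op (w * q) T v"
    have "v = v1 + v2"
      unfolding v1_def v2_def using poly_op_add[symmetric] uw by (metis poly_op_1)
    moreover have "v2 \<in> ?E v"
    proof -
      have "poly_op ([:- c, 1:] ^ n) T v2 = poly_op (w * f) T v"
        unfolding v2_def q(1) by (simp add: ac_simps flip: poly_op_mult[OF T])
      also have "\<dots> = 0"
        using less.prems(2) clinear_0[OF clinear_poly_op[OF T]] by (simp add: poly_op_mult[OF T])
      finally show ?thesis
        unfolding poly_op_linear_power[OF T] v2_def by blast
    qed
    moreover have "v1 \<in> cvs.span (?E v)"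
    proof -
      have "poly_op q T v1 = poly_op (u * f) T v"
        unfolding v1_def q(1) by (simp add: ac_simps flip: poly_op_mult[OF T])
      also have "\<dots> = 0"
        using less.prems(2) clinear_0[OF clinear_poly_op[OF T]] by (simp add: poly_op_mult[OF T])
      finally have "v1 \<in> cvs.span (?E v1)"
        using less.hyps[OF deg \<open>q \<noteq> 0\<close>] by simp
      moreover have "?E v1 \<subseteq> ?E v"
        unfolding v1_def poly_op_mult[OF T, symmetric] by blast
      ultimately show ?thesis using cvs.span_mono by blast
    qed
    ultimately show ?thesis by (simp add: cvs.span_add cvs.span_base)
  qed
qed

section \<open>Joint generalised weight spaces\<close>

text \<open>Only the values of \<open>\<chi>\<close> on \<open>U\<close> matter, and
  \<open>\<chi>\<close> is not asked to be linear. In the applications \<open>U\<close> is a finite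
  spanning set, which allows the operators to be treated one at a time; the nilpotency exponent may
  vary with \<open>u\<close>.\<close>

definition gen_weight_space ::
  "('h \<Rightarrow> 'm::complex_vector \<Rightarrow> 'm) \<Rightarrow> 'h set \<Rightarrow> ('h \<Rightarrow> complex) \<Rightarrow> 'm set" where
  "gen_weight_space \<rho> U \<chi> = {w. \<forall>u\<in>U. \<exists>n. ((\<lambda>v. \<rho> u v - \<chi> u *\<^sub>C v) ^^ n) w = 0}"

lemma h_moduleD:
  assumes "h_module \<rho>"
  shows "clinear (\<rho> z)" "clinear (\<lambda>z. \<rho> z v)" "\<rho> x (\<rho> y v) = \<rho> y (\<rho> x v)"
  using assms by (simp_all add: h_module_def cbilinear_def)

lemma clinear_shift: "clinear T \<Longrightarrow> clinear (\<lambda>v. T v - c *\<^sub>C v)"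
  by (simp add: clinear_iff algebra_simps)

lemma funpow_commute: "(\<And>v. S (T v) = T (S v)) \<Longrightarrow> S ((T ^^ n) v) = (T ^^ n) (S v)"
  by (induction n) simp_all

lemma gen_weight_space_stable:
  assumes S: "clinear S" and comm: "\<And>u v. S (\<rho> u v) = \<rho> u (S v)"
    and w: "w \<in> gen_weight_space \<rho> U \<chi>"
  shows "S w \<in> gen_weight_space \<rho> U \<chi>"
proof -
  have "((\<lambda>v. \<rho> u v - \<chi> u *\<^sub>C v) ^^ n) (S w) = S (((\<lambda>v. \<rho> u v - \<chi> u *\<^sub>C v) ^^ n) w)" for u n
    using S by (intro funpow_commute[symmetric]) (simp add: comm clinear_diff clinear_iff)
  then show ?thesis using w clinear_0[OF S] unfolding gen_weight_space_def mem_Collect_eq by metis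
qed

text \<open>The operators are added one at a time, each splitting the spaces obtained so far by
  primary decomposition. The new pieces are polynomials in \<open>\<rho> u\<close> applied to old
  vectors, and since the operators commute they keep their generalised weights for
  \<open>U\<close>.\<close>

lemma gen_weight_space_span:
  assumes mod: "h_module \<rho>" and lf: "locally_finite \<rho>" and "finite U"
  shows "v \<in> cvs.span (\<Union>\<chi>. gen_weight_space \<rho> U \<chi>)"
  using \<open>finite U\<close>
proof (induction U arbitrary: v)
  case empty
  then show ?case by (simp add: gen_weight_space_def cvs.span_UNIV)
next
  case (insert u U)
  have "w \<in> cvs.span (\<Union>\<chi>. gen_weight_space \<rho> (insert u U) \<chi>)"
    if w: "w \<in> gen_weight_space \<rho> U \<chi>" for w \<chi>
  proof -
    obtain f where "f \<noteq> 0" "poly_op f (\<rho> u) w = 0"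
      using lf unfolding locally_finite_def by blast
    from primary_decomposition[OF h_moduleD(1)[OF mod] this] show ?thesis
    proof (rule subsetD[OF cvs.span_mono, rotated], intro subsetI)
      fix w' assume "w' \<in> {w'. \<exists>p c n. w' = poly_op p (\<rho> u) w \<and>
        ((\<lambda>x. \<rho> u x - c *\<^sub>C x) ^^ n) w' = 0}"
      then obtain p c n where w': "w' = poly_op p (\<rho> u) w"
        "((\<lambda>x. \<rho> u x - c *\<^sub>C x) ^^ n) w' = 0" by blast
      have comm: "\<rho> x (poly_op p (\<rho> u) v) = poly_op p (\<rho> u) (\<rho> x v)" for x v
        by (rule poly_op_commute) (simp_all add: h_moduleD[OF mod])
      have "w' \<in> gen_weight_space \<rho> U \<chi>"
        unfolding w'(1)
        by (rule gen_weight_space_stable[OF _ comm[symmetric] w])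
          (rule clinear_poly_op[OF h_moduleD(1)[OF mod]])
      \<comment> \<open>As \<open>u\<close> is not in \<open>U\<close>, the update at
        \<open>u\<close> leaves the conditions on \<open>U\<close> untouched.\<close>
      then have "w' \<in> gen_weight_space \<rho> (insert u U) (\<chi>(u := c))"
        using w'(2) insert.hyps(2) by (auto simp: gen_weight_space_def)
      then show "w' \<in> (\<Union>\<chi>. gen_weight_space \<rho> (insert u U) \<chi>)" by blast
    qed
  qed
  then have "cvs.span (\<Union>\<chi>. gen_weight_space \<rho> U \<chi>) \<subseteq>
      cvs.span (\<Union>\<chi>. gen_weight_space \<rho> (insert u U) \<chi>)"
    by (intro cvs.span_minimal) auto
  then show ?case using insert.IH by blast
qed

text \<open>In the binomial expansion of \<open>(D'' ^^ (m + n)) (a * b)\<close> every term applies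
  \<open>D\<close> to \<open>a\<close> at least \<open>m\<close> times or \<open>D'\<close> to
  \<open>b\<close> at least \<open>n\<close> times. Three maps are needed because the operators of
  interest are one derivation shifted by \<chi>, by \<psi> and by their sum.\<close>

lemma leibniz_funpow_zero:
  fixes D D' D'' :: "'a::complex_algebra_1 \<Rightarrow> 'a"
  assumes lin: "clinear D''" and L: "\<And>a b. D'' (a * b) = D a * b + a * D' b"
    and zero: "D 0 = 0" "D' 0 = 0"
    and "(D ^^ m) a = 0" "(D' ^^ n) b = 0"
  shows "(D'' ^^ (m + n)) (a * b) = 0"
  using assms(5,6)
proof (induction "m + n" arbitrary: m n a b)
  case 0
  then show ?case by simp
next
  case (Suc k)
  note lin_pow = clinear_funpow[OF lin]
  consider "m = 0 \<or> n = 0" | m' n' where "m = Suc m'" "n = Suc n'"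
    by (meson not0_implies_Suc)
  then show ?case
  proof cases
    case 1
    then have "a * b = 0" using Suc.prems by auto
    then show ?thesis using clinear_0[OF lin_pow] by metis
  next
    case 2
    have "(D'' ^^ k) (D a * b) = 0"
      using Suc.hyps(1)[of m' n "D a" b] Suc.hyps(2) Suc.prems 2 by (simp add: funpow_swap1)
    moreover have "(D'' ^^ k) (a * D' b) = 0"
      using Suc.hyps(1)[of m n' a "D' b"] Suc.hyps(2) Suc.prems 2 by (simp add: funpow_swap1)
    moreover have "(D'' ^^ (m + n)) (a * b) = (D'' ^^ k) (D'' (a * b))"
      unfolding Suc.hyps(2)[symmetric] by (simp add: funpow_swap1)
    ultimately show ?thesis
      using lin_pow[of k] by (simp add: L clinear_iff)
  qed
qed

lemma gen_weight_space_mult: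
  fixes \<rho> :: "'h::complex_vector \<Rightarrow> 'a::complex_algebra_1 \<Rightarrow> 'a"
  assumes "h_algebra \<rho>" "a \<in> gen_weight_space \<rho> U \<chi>" "b \<in> gen_weight_space \<rho> U \<psi>"
  shows "a * b \<in> gen_weight_space \<rho> U (\<lambda>u. \<chi> u + \<psi> u)"
  unfolding gen_weight_space_def
proof (intro CollectI ballI)
  fix u assume "u \<in> U"
  let ?D = "\<lambda>c v. \<rho> u v - c *\<^sub>C v"
  have lin: "clinear (\<rho> u)" and der: "\<And>a b. \<rho> u (a * b) = \<rho> u a * b + a * \<rho> u b"
    using assms(1) by (simp_all add: h_algebra_def h_moduleD)
  obtain m n where "(?D (\<chi> u) ^^ m) a = 0" "(?D (\<psi> u) ^^ n) b = 0"
    using assms(2,3) \<open>u \<in> U\<close> unfolding gen_weight_space_def by blast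
  then have "(?D (\<chi> u + \<psi> u) ^^ (m + n)) (a * b) = 0"
    by (intro leibniz_funpow_zero[where D = "?D (\<chi> u)" and D' = "?D (\<psi> u)"]
        clinear_shift[OF lin])
      (simp_all add: clinear_0[OF lin] der scaleC_add_left
        mult_scaleC_left mult_scaleC_right algebra_simps)
  then show "\<exists>n. (?D (\<chi> u + \<psi> u) ^^ n) (a * b) = 0" by blast
qed

text \<open>Applying \<open>T - c\<close> shortens the nilpotency exponent, so inductively \<phi>
  kills \<open>T w - c w\<close>; it also kills \<open>T w\<close>, which leaves
  \<open>c * \<phi> w = 0\<close>.\<close>

lemma functional_gen_eigenvector_zero:
  assumes lin: "clinear \<phi>" and inv: "\<And>v. \<phi> (T v) = 0"
    and "c \<noteq> 0" "((\<lambda>v. T v - c *\<^sub>C v) ^^ n) w = 0"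
  shows "\<phi> w = (0::complex)"
  using assms(4)
proof (induction n arbitrary: w)
  case 0
  then show ?case using clinear_0[OF lin] by simp
next
  case (Suc n)
  then have "\<phi> (T w - c *\<^sub>C w) = 0"
    by (intro Suc.IH) (simp add: funpow_Suc_right del: funpow.simps)
  then show ?case
    using lin \<open>c \<noteq> 0\<close> by (simp add: clinear_diff inv) (simp add: clinear_iff scaleC_complex_def)
qed

text \<open>If \<open>D x = 1\<close>, then \<open>x\<^sup>k w = D (x\<^sup>k\<^sup>+\<^sup>1 w / (k + 1)) - x\<^sup>k\<^sup>+\<^sup>1 D w / (k + 1)\<close>, so every vector
  on which \<open>D\<close> is nilpotent lies in the image of \<open>D\<close>.\<close>

lemma functional_slice_zero:
  fixes D :: "'a::complex_algebra_1 \<Rightarrow> 'a" and \<phi> :: "'a \<Rightarrow> complex"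
  assumes D: "clinear D" and der: "\<And>a b. D (a * b) = D a * b + a * D b"
    and lf: "\<And>a. \<exists>f. f \<noteq> 0 \<and> poly_op f D a = 0"
    and lin: "clinear \<phi>" and inv: "\<And>a. \<phi> (D a) = 0" and x: "D x = 1"
  shows "\<phi> a = 0"
proof -
  have pow: "D (x ^ Suc k) = of_nat (Suc k) * x ^ k" for k
  proof (induction k)
    case (Suc k)
    have "D (x ^ Suc (Suc k)) = D x * x ^ Suc k + x * D (x ^ Suc k)"
      using der[of x "x ^ Suc k"] by simp
    also have "\<dots> = x ^ Suc k + of_nat (Suc k) * x ^ Suc k"
      unfolding Suc.IH x by (simp add: mult_of_nat_commute algebra_simps)
    finally show ?case by (simp add: algebra_simps)
  qed (simp add: x)
  \<comment> \<open>The power of \<open>x\<close> is kept general because integration by parts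
    trades one step of nilpotency of \<open>w\<close> for one more factor \<open>x\<close>; only
    \<open>k = 0\<close> is used afterwards.\<close>
  have nilp: "\<phi> (x ^ k * w) = 0" if "(D ^^ n) w = 0" for n k w
    using that
  proof (induction n arbitrary: k w)
    case 0
    then show ?case using clinear_0[OF lin] by simp
  next
    case (Suc n)
    have "D (x ^ Suc k * w) = of_nat (Suc k) * (x ^ k * w) + x ^ Suc k * D w"
      unfolding der pow by (simp add: mult.assoc)
    moreover have "\<phi> (x ^ Suc k * D w) = 0"
      using Suc.prems by (intro Suc.IH) (simp add: funpow_swap1)
    moreover have "\<phi> (of_nat m * a) = of_nat m * \<phi> a" for m a
      using lin by (induction m) (simp_all add: clinear_0 clinear_iff algebra_simps)
    ultimately have "of_nat (Suc k) * \<phi> (x ^ k * w) = 0"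
      using inv[of "x ^ Suc k * w"] lin by (simp add: clinear_iff del: of_nat_Suc power_Suc)
    then show ?case by (simp del: of_nat_Suc)
  qed
  obtain f where "f \<noteq> 0" "poly_op f D a = 0" using lf by blast
  then have "a \<in> cvs.span {w. \<exists>p c n. w = poly_op p D a \<and> ((\<lambda>x. D x - c *\<^sub>C x) ^^ n) w = 0}"
    by (rule primary_decomposition[OF D])
  also have "\<dots> \<subseteq> {w. \<phi> w = 0}"
  proof (rule cvs.span_minimal)
    show "cvs.subspace {w. \<phi> w = 0}"
      using lin by (intro cvs.subspaceI) (auto simp: clinear_0 clinear_iff scaleC_complex_def)
    show "{w. \<exists>p c n. w = poly_op p D a \<and> ((\<lambda>x. D x - c *\<^sub>C x) ^^ n) w = 0} \<subseteq> {w. \<phi> w = 0}"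
    proof clarify
      fix p c n assume *: "((\<lambda>x. D x - c *\<^sub>C x) ^^ n) (poly_op p D a) = 0"
      show "\<phi> (poly_op p D a) = 0"
      \<comment> \<open>For \<open>c = 0\<close> the operator is nilpotent on the piece and
        \<open>nilp\<close> applies; for other \<open>c\<close> the invariance of \<phi> alone
        suffices.\<close>
      proof (cases "c = 0")
        case True
        then show ?thesis using * nilp[of n "poly_op p D a" 0] by simp
      next
        case False
        then show ?thesis using functional_gen_eigenvector_zero[OF lin inv _ *] by blast
      qed
    qed
  qed
  finally show ?thesis by simp
qed

section \<open>Cocycles\<close>

text \<open>A complement \<open>F\<close> of the central copy \<open>Z\<close> of the multiplicative
  group meets each fibre over \<open>x\<close> in exactly one point \<open>(\<gamma> x, x)\<close>.
  Closure of \<open>F\<close> under the twisted product is the required formula.\<close>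

lemma symmetric_cocycle_coboundary:
  fixes L :: "'h::ab_group_add set"
  assumes L: "add_subgroup L" and coc: "normalised_cocycle L \<delta>"
    and sym: "\<And>x y. x \<in> L \<Longrightarrow> y \<in> L \<Longrightarrow> \<delta> x y = \<delta> y x"
  obtains \<gamma> where "\<And>x. x \<in> L \<Longrightarrow> \<gamma> x \<noteq> 0"
    "\<And>x y. x \<in> L \<Longrightarrow> y \<in> L \<Longrightarrow> \<gamma> (x + y) = \<delta> x y * (\<gamma> x * \<gamma> y)"
proof -
  \<comment> \<open>The extension of \<open>L\<close> by the nonzero scalars: associativity is the
    cocycle identity, commutativity the symmetry of \<delta>, and normalisation makes
    \<open>(1, 0)\<close> the unit.\<close>
  define G :: "(complex \<times> 'h) monoid" where
    "G = \<lparr>carrier = (- {0}) \<times> L,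
      monoid.mult = (\<lambda>p q. (fst p * fst q * \<delta> (snd p) (snd q), snd p + snd q)), one = (1, 0)\<rparr>"
  define Z :: "(complex \<times> 'h) set" where "Z = (- {0}) \<times> {0}"
  have car: "(c, x) \<in> carrier G \<longleftrightarrow> c \<noteq> 0 \<and> x \<in> L" for c x by (simp add: G_def)
  have mul: "(c, x) \<otimes>\<^bsub>G\<^esub> (d, y) = (c * d * \<delta> x y, x + y)" for c d x y by (simp add: G_def)
  have one: "\<one>\<^bsub>G\<^esub> = (1, 0)" by (simp add: G_def)
  have L0: "0 \<in> L" and Ladd: "x \<in> L \<Longrightarrow> y \<in> L \<Longrightarrow> x + y \<in> L"
    and Lneg: "x \<in> L \<Longrightarrow> - x \<in> L" for x y
    using L by (simp_all add: add_subgroup_def)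
  have nz: "x \<in> L \<Longrightarrow> y \<in> L \<Longrightarrow> \<delta> x y \<noteq> 0" for x y
    using coc by (simp add: normalised_cocycle_def)
  have unit: "x \<in> L \<Longrightarrow> \<delta> x 0 = 1" "x \<in> L \<Longrightarrow> \<delta> 0 x = 1" for x
    using coc by (simp_all add: normalised_cocycle_def)
  have cocycle: "x \<in> L \<Longrightarrow> y \<in> L \<Longrightarrow> z \<in> L \<Longrightarrow>
      \<delta> y z * \<delta> x (y + z) = \<delta> (x + y) z * \<delta> x y" for x y z
    using coc by (simp add: normalised_cocycle_def)
  interpret G: comm_group G
  proof (rule comm_groupI)
    fix p q r assume p: "p \<in> carrier G" and q: "q \<in> carrier G" and r: "r \<in> carrier G"
    obtain c x d y e z where pqr: "p = (c, x)" "q = (d, y)" "r = (e, z)" by (meson surj_pair)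
    have in_L: "c \<noteq> 0" "x \<in> L" "d \<noteq> 0" "y \<in> L" "e \<noteq> 0" "z \<in> L"
      using p q r by (simp_all add: pqr car)
    show "p \<otimes>\<^bsub>G\<^esub> q \<in> carrier G" using in_L by (simp add: pqr mul car nz Ladd)
    show "p \<otimes>\<^bsub>G\<^esub> q \<otimes>\<^bsub>G\<^esub> r = p \<otimes>\<^bsub>G\<^esub> (q \<otimes>\<^bsub>G\<^esub> r)"
      using cocycle[of x y z] in_L by (simp add: pqr mul add.assoc ac_simps)
    show "p \<otimes>\<^bsub>G\<^esub> q = q \<otimes>\<^bsub>G\<^esub> p" using in_L sym[of x y] by (simp add: pqr mul ac_simps)
    show "\<one>\<^bsub>G\<^esub> \<otimes>\<^bsub>G\<^esub> p = p" using in_L by (simp add: pqr mul one unit)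
    have "(1 / (c * \<delta> (- x) x), - x) \<otimes>\<^bsub>G\<^esub> p = \<one>\<^bsub>G\<^esub>"
      using in_L nz[of "- x" x] Lneg by (simp add: pqr mul one)
    moreover have "(1 / (c * \<delta> (- x) x), - x) \<in> carrier G"
      using in_L nz[of "- x" x] Lneg by (simp add: car)
    ultimately show "\<exists>q\<in>carrier G. q \<otimes>\<^bsub>G\<^esub> p = \<one>\<^bsub>G\<^esub>" by blast
  qed (simp add: one car L0)
  have Z: "subgroup Z G"
  proof (rule G.subgroupI)
    show "Z \<subseteq> carrier G" by (auto simp: Z_def car L0)
    have "(1, 0) \<in> Z" by (simp add: Z_def)
    then show "Z \<noteq> {}" by blast
    show "a \<otimes>\<^bsub>G\<^esub> b \<in> Z" if "a \<in> Z" "b \<in> Z" for a b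
      using that by (auto simp: Z_def mul unit L0)
    fix a assume "a \<in> Z"
    then obtain c where c: "a = (c, 0)" "c \<noteq> 0" by (auto simp: Z_def)
    have "inv\<^bsub>G\<^esub> a = (1 / c, 0)"
      by (rule G.inv_equality) (use c in \<open>simp_all add: mul one car unit L0\<close>)
    then show "inv\<^bsub>G\<^esub> a \<in> Z" using c by (simp add: Z_def)
  qed
  have "\<exists>w\<in>Z. w [^]\<^bsub>G\<^esub> n = z" if z: "z \<in> Z" and n: "0 < n" for z and n :: nat
  proof -
    obtain c where c: "z = (c, 0)" "c \<noteq> 0" using z by (auto simp: Z_def)
    \<comment> \<open>An \<open>n\<close>-th root of \<open>c\<close> in polar form; on
      \<open>Z\<close> the twisted product is ordinary multiplication of scalars.\<close>
    define w where "w = rcis (root n (cmod c)) (Arg c / n)"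
    have w: "w ^ n = c"
      using n by (simp add: w_def DeMoivre2 rcis_cmod_Arg)
    have "(w, 0) [^]\<^bsub>G\<^esub> m = (w ^ m, 0)" for m :: nat
      by (induction m) (simp_all add: one mul unit L0)
    moreover have "w \<noteq> 0" using w c n by (auto simp: power_0_left)
    ultimately show ?thesis using w c by (auto simp: Z_def)
  qed
  then obtain F where F: "subgroup F G" "F \<inter> Z = {\<one>\<^bsub>G\<^esub>}" "carrier G = F <#>\<^bsub>G\<^esub> Z"
    using G.divisible_subgroup_complement[OF Z] by blast
  have F_car: "c \<noteq> 0" "x \<in> L" if "(c, x) \<in> F" for c x
    using that subgroup.subset[OF F(1)] car by blast+
  have ex: "\<exists>c. (c, x) \<in> F" if "x \<in> L" for x
  proof -
    have "(1, x) \<in> F <#>\<^bsub>G\<^esub> Z" using that F(3) car by simp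
    then show ?thesis by (auto simp: set_mult_def Z_def mul)
  qed
  \<comment> \<open>Two points of \<open>F\<close> over the same \<open>x\<close> differ by an
    element of \<open>F \<inter> Z\<close>, which is trivial.\<close>
  have uniq: "c = d" if c: "(c, x) \<in> F" and d: "(d, x) \<in> F" for c d x
  proof -
    obtain e y where ey: "inv\<^bsub>G\<^esub> (c, x) = (e, y)" by fastforce
    have inF: "(e, y) \<in> F" using subgroup.m_inv_closed[OF F(1) c] by (simp add: ey)
    have "(e, y) \<otimes>\<^bsub>G\<^esub> (c, x) = \<one>\<^bsub>G\<^esub>"
      using G.l_inv[of "(c, x)"] subgroup.mem_carrier[OF F(1) c] by (simp add: ey)
    then have e: "e * c * \<delta> y x = 1" "y + x = 0" by (simp_all add: mul one)
    have "(e * d * \<delta> y x, 0) \<in> F"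
      using subgroup.m_closed[OF F(1) inF d] e(2) by (simp add: mul)
    moreover have "e * d * \<delta> y x \<noteq> 0"
      using F_car[OF inF] F_car[OF d] nz by simp
    ultimately have "(e * d * \<delta> y x, 0) \<in> F \<inter> Z" by (simp add: Z_def)
    then have "e * d * \<delta> y x = 1" unfolding F(2) one by simp
    with e(1) have "e * d * \<delta> y x = e * c * \<delta> y x" by simp
    then show ?thesis using F_car[OF inF] F_car[OF d] nz by simp
  qed
  define \<gamma> where "\<gamma> x = (SOME c. (c, x) \<in> F)" for x
  have \<gamma>: "(\<gamma> x, x) \<in> F" if "x \<in> L" for x
    unfolding \<gamma>_def using ex[OF that] by (rule someI_ex)
  show thesis
  proof (rule that)
    show "\<gamma> x \<noteq> 0" if "x \<in> L" for x using F_car[OF \<gamma>[OF that]] by blast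
    show "\<gamma> (x + y) = \<delta> x y * (\<gamma> x * \<gamma> y)" if "x \<in> L" "y \<in> L" for x y
    proof (rule uniq)
      show "(\<gamma> (x + y), x + y) \<in> F" by (rule \<gamma>[OF Ladd[OF that]])
      show "(\<delta> x y * (\<gamma> x * \<gamma> y), x + y) \<in> F"
        using subgroup.m_closed[OF F(1) \<gamma> \<gamma>, OF that] by (simp add: mul ac_simps)
    qed
  qed
qed

lemma commutator_condition_cohomologous:
  assumes L: "add_subgroup L"
    and \<alpha>: "normalised_cocycle L \<alpha>" "commutator_condition form L \<alpha>"
    and \<alpha>': "normalised_cocycle L \<alpha>'" "commutator_condition form L \<alpha>'"
  shows "cohomologous L \<alpha> \<alpha>'"
proof -
  define \<delta> where "\<delta> x y = \<alpha> x y / \<alpha>' x y" for x y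
  have nz: "x \<in> L \<Longrightarrow> y \<in> L \<Longrightarrow> \<alpha> x y \<noteq> 0" "x \<in> L \<Longrightarrow> y \<in> L \<Longrightarrow> \<alpha>' x y \<noteq> 0" for x y
    using \<alpha>(1) \<alpha>'(1) by (simp_all add: normalised_cocycle_def)
  have "\<delta> y z * \<delta> x (y + z) = \<delta> (x + y) z * \<delta> x y" if "x \<in> L" "y \<in> L" "z \<in> L" for x y z
    unfolding \<delta>_def times_divide_times_eq
    using \<alpha>(1) \<alpha>'(1) that by (metis normalised_cocycle_def)
  then have coc: "normalised_cocycle L \<delta>"
    using \<alpha>(1) \<alpha>'(1) by (simp add: normalised_cocycle_def \<delta>_def)
  have "\<delta> x y = \<delta> y x" if "x \<in> L" "y \<in> L" for x y
  proof -
    have "\<alpha> x y / \<alpha> y x = \<alpha>' x y / \<alpha>' y x"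
      using \<alpha>(2) \<alpha>'(2) that by (simp add: commutator_condition_def)
    then show ?thesis using nz that by (simp add: \<delta>_def field_simps)
  qed
  then obtain \<gamma> where \<gamma>: "\<And>x. x \<in> L \<Longrightarrow> \<gamma> x \<noteq> 0"
    "\<And>x y. x \<in> L \<Longrightarrow> y \<in> L \<Longrightarrow> \<gamma> (x + y) = \<delta> x y * (\<gamma> x * \<gamma> y)"
    using symmetric_cocycle_coboundary[OF L coc] by blast
  \<comment> \<open>\<delta> was taken as \<alpha> over \<alpha>', and it equals
    \<open>\<gamma> (x + y) / (\<gamma> x * \<gamma> y)\<close>; dividing \<alpha> by it gives
    \<alpha>'.\<close>
  have "\<alpha>' x y = \<alpha> x y * (\<gamma> y * \<gamma> x / \<gamma> (x + y))" if "x \<in> L" "y \<in> L" for x y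
    unfolding \<gamma>(2)[OF that] using \<gamma>(1) nz that by (simp add: \<delta>_def)
  then show ?thesis unfolding cohomologous_def using \<gamma>(1) by blast
qed

section \<open>Isomorphisms of skew group algebras\<close>

text \<open>The inverse of the bijection works. Closure of the carrier of \<open>A\<close> is
  assumed because the inverse cancels \<open>f\<close> only on that carrier, and it has to do so on
  sums, multiples, products, the unit and images under the action.\<close>

lemma halg_iso_sym:
  assumes add: "\<And>a b. a \<in> alg_carrier A \<Longrightarrow> b \<in> alg_carrier A \<Longrightarrow> a + b \<in> alg_carrier A"
    and scale: "\<And>c a. a \<in> alg_carrier A \<Longrightarrow> c *\<^sub>C a \<in> alg_carrier A"
    and mult: "\<And>a b. a \<in> alg_carrier A \<Longrightarrow> b \<in> alg_carrier A \<Longrightarrow> alg_mult A a b \<in> alg_carrier A"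
    and one: "alg_one A \<in> alg_carrier A"
    and act: "\<And>z a. a \<in> alg_carrier A \<Longrightarrow> alg_act A z a \<in> alg_carrier A"
    and "A \<cong>\<^sub>h B"
  shows "B \<cong>\<^sub>h A"
proof -
  obtain f where bij: "bij_betw f (alg_carrier A) (alg_carrier B)"
    and f: "\<And>a b. a \<in> alg_carrier A \<Longrightarrow> b \<in> alg_carrier A \<Longrightarrow> f (a + b) = f a + f b"
    "\<And>c a. a \<in> alg_carrier A \<Longrightarrow> f (c *\<^sub>C a) = c *\<^sub>C f a"
    "\<And>a b. a \<in> alg_carrier A \<Longrightarrow> b \<in> alg_carrier A \<Longrightarrow> f (alg_mult A a b) = alg_mult B (f a) (f b)"
    "f (alg_one A) = alg_one B"
    "\<And>z a. a \<in> alg_carrier A \<Longrightarrow> f (alg_act A z a) = alg_act B z (f a)"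
    using \<open>A \<cong>\<^sub>h B\<close> unfolding halg_iso_def by auto
  define g where "g = inv_into (alg_carrier A) f"
  have gf: "g (f a) = a" if "a \<in> alg_carrier A" for a
    unfolding g_def using bij that by (simp add: bij_betw_def)
  have B: "alg_carrier B = f ` alg_carrier A" using bij by (simp add: bij_betw_def)
  have "bij_betw g (alg_carrier B) (alg_carrier A)"
    unfolding g_def by (rule bij_betw_inv_into[OF bij])
  then show ?thesis
    unfolding halg_iso_def
    by (intro exI[of _ g])
      (simp add: B gf f(4)[symmetric] f(1,2,3,5)[symmetric] add scale mult one act)
qed

lemma keys_subset_subspace: "cvs.subspace {f :: 'x \<Rightarrow>\<^sub>0 complex. Poly_Mapping.keys f \<subseteq> L}"
proof (rule cvs.subspaceI)
  fix f g :: "'x \<Rightarrow>\<^sub>0 complex" and c :: complex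
  assume f: "f \<in> {f. Poly_Mapping.keys f \<subseteq> L}"
  have "Poly_Mapping.keys (c *\<^sub>C f) \<subseteq> Poly_Mapping.keys f"
    by (auto simp: in_keys_iff scaleC_complex_def)
  then show "c *\<^sub>C f \<in> {f. Poly_Mapping.keys f \<subseteq> L}" using f by blast
  assume "g \<in> {f. Poly_Mapping.keys f \<subseteq> L}"
  then show "f + g \<in> {f. Poly_Mapping.keys f \<subseteq> L}"
    using f Poly_Mapping.keys_add[of f g] by blast
qed simp

lemma skew_group_algebra_closed:
  fixes form :: "'h::complex_vector \<Rightarrow> 'h \<Rightarrow> complex" and \<alpha> :: "'h \<Rightarrow> 'h \<Rightarrow> complex"
  assumes L: "add_subgroup L"
  defines "A \<equiv> skew_group_algebra form L \<alpha>"
  shows "a \<in> alg_carrier A \<Longrightarrow> b \<in> alg_carrier A \<Longrightarrow> a + b \<in> alg_carrier A"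
    and "a \<in> alg_carrier A \<Longrightarrow> c *\<^sub>C a \<in> alg_carrier A"
    and "a \<in> alg_carrier A \<Longrightarrow> b \<in> alg_carrier A \<Longrightarrow> alg_mult A a b \<in> alg_carrier A"
    and "alg_one A \<in> alg_carrier A"
    and "a \<in> alg_carrier A \<Longrightarrow> alg_act A z a \<in> alg_carrier A"
proof -
  have car: "alg_carrier A = {f. Poly_Mapping.keys f \<subseteq> L}"
    by (simp add: A_def skew_group_algebra_def)
  have single: "Poly_Mapping.single x d \<in> alg_carrier A" if "x \<in> L" for x d
    unfolding car using that by simp
  have sub: "cvs.subspace (alg_carrier A)" unfolding car by (rule keys_subset_subspace)
  show "a \<in> alg_carrier A \<Longrightarrow> b \<in> alg_carrier A \<Longrightarrow> a + b \<in> alg_carrier A"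
    by (rule cvs.subspace_add[OF sub])
  show "a \<in> alg_carrier A \<Longrightarrow> c *\<^sub>C a \<in> alg_carrier A"
    by (rule cvs.subspace_scale[OF sub])
  show "alg_one A \<in> alg_carrier A"
    using L single by (simp add: A_def skew_group_algebra_def add_subgroup_def)
  show "alg_mult A a b \<in> alg_carrier A" if "a \<in> alg_carrier A" "b \<in> alg_carrier A"
  proof -
    have "x + y \<in> L" if "x \<in> Poly_Mapping.keys a" "y \<in> Poly_Mapping.keys b" for x y
      using that \<open>a \<in> _\<close> \<open>b \<in> _\<close> L by (auto simp: car add_subgroup_def)
    then have "(\<Sum>x\<in>Poly_Mapping.keys a. \<Sum>y\<in>Poly_Mapping.keys b. Poly_Mapping.single (x + y)
        (Poly_Mapping.lookup a x * Poly_Mapping.lookup b y * \<alpha> x y)) \<in> alg_carrier A"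
      by (intro cvs.subspace_sum[OF sub] single)
    then show ?thesis by (simp add: A_def skew_group_algebra_def)
  qed
  show "alg_act A z a \<in> alg_carrier A" if "a \<in> alg_carrier A"
  proof -
    have "(\<Sum>x\<in>Poly_Mapping.keys a. Poly_Mapping.single x (form x z * Poly_Mapping.lookup a x))
        \<in> alg_carrier A"
      by (intro cvs.subspace_sum[OF sub] single) (use that in \<open>auto simp: car\<close>)
    then show ?thesis by (simp add: A_def skew_group_algebra_def)
  qed
qed

lemma lookup_free_lift_single:
  "Poly_Mapping.lookup (free_lift (\<lambda>x. Poly_Mapping.single x (g x)) f) y =
     Poly_Mapping.lookup f y * (g y :: complex)"
proof -
  have "Poly_Mapping.lookup (free_lift (\<lambda>x. Poly_Mapping.single x (g x)) f) y =
      (\<Sum>x\<in>Poly_Mapping.keys f. if x = y then Poly_Mapping.lookup f y * g y else 0)"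
    unfolding free_lift_def lookup_sum
    by (intro sum.cong) (auto simp: scaleC_complex_def lookup_single)
  then show ?thesis by (simp add: in_keys_iff)
qed

text \<open>The isomorphism rescales the basis, sending each \<open>e_x\<close> to
  \<open>e_x / \<gamma> x\<close>. It commutes with the action because both are diagonal, and the
  coboundary relation is exactly its compatibility with the products.\<close>

lemma cohomologous_halg_iso:
  fixes form :: "'h::complex_vector \<Rightarrow> 'h \<Rightarrow> complex"
  assumes L: "add_subgroup L" and "cohomologous L \<alpha> \<alpha>'"
    and coc: "normalised_cocycle L \<alpha>" "normalised_cocycle L \<alpha>'"
  shows "skew_group_algebra form L \<alpha> \<cong>\<^sub>h skew_group_algebra form L \<alpha>'"
proof -
  obtain \<gamma> where \<gamma>: "\<And>x. x \<in> L \<Longrightarrow> \<gamma> x \<noteq> 0"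
    "\<And>x y. x \<in> L \<Longrightarrow> y \<in> L \<Longrightarrow> \<alpha>' x y = \<alpha> x y * (\<gamma> y * \<gamma> x / \<gamma> (x + y))"
    using assms(2) unfolding cohomologous_def by blast
  have L0: "0 \<in> L" and Ladd: "x \<in> L \<Longrightarrow> y \<in> L \<Longrightarrow> x + y \<in> L" for x y
    using L by (simp_all add: add_subgroup_def)
  define D where "D g = free_lift (\<lambda>x. Poly_Mapping.single x (g x))" for g :: "'h \<Rightarrow> complex"
  have lin: "clinear (D g)" for g unfolding D_def by (rule clinear_free_lift)
  have lookup_D: "Poly_Mapping.lookup (D g f) x = Poly_Mapping.lookup f x * g x" for g f x
    unfolding D_def by (rule lookup_free_lift_single)
  have D_single: "D g (Poly_Mapping.single x c) = Poly_Mapping.single x (c * g x)" for g x c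
    by (simp add: D_def scaleC_single)
  let ?C = "{f :: 'h \<Rightarrow>\<^sub>0 complex. Poly_Mapping.keys f \<subseteq> L}"
  let ?g = "\<lambda>x. 1 / \<gamma> x"
  have keys_D: "Poly_Mapping.keys (D ?g f) = Poly_Mapping.keys f" if "f \<in> ?C" for f
    using that \<gamma>(1) by (fastforce simp: in_keys_iff lookup_D)
  have "\<alpha> 0 0 = 1" "\<alpha>' 0 0 = 1" using coc L0 by (simp_all add: normalised_cocycle_def)
  \<comment> \<open>Both cocycles are normalised, which forces the rescaling to fix the unit
    \<open>e_0\<close>.\<close>
  then have "\<gamma> 0 = 1" using \<gamma>(2)[OF L0 L0] \<gamma>(1)[OF L0] by simp
  have bij: "bij_betw (D ?g) ?C ?C"
  proof (rule bij_betw_byWitness[where f' = "D \<gamma>"])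
    show "\<forall>f\<in>?C. D \<gamma> (D ?g f) = f" "\<forall>f\<in>?C. D ?g (D \<gamma> f) = f"
      using \<gamma>(1) by (auto intro!: poly_mapping_eqI simp: lookup_D in_keys_iff subset_iff) blast+
    show "D ?g ` ?C \<subseteq> ?C" "D \<gamma> ` ?C \<subseteq> ?C"
      by (auto simp: in_keys_iff lookup_D)
  qed
  let ?A = "skew_group_algebra form L \<alpha>" and ?A' = "skew_group_algebra form L \<alpha>'"
  have mult: "D ?g (alg_mult ?A a b) = alg_mult ?A' (D ?g a) (D ?g b)"
    if "a \<in> ?C" "b \<in> ?C" for a b
  proof -
    have eq: "u * v * \<alpha> x y / \<gamma> (x + y) = u * v * \<alpha>' x y / (\<gamma> y * \<gamma> x)"
      if "x \<in> Poly_Mapping.keys a" "y \<in> Poly_Mapping.keys b" for x y u v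
    proof -
      have "x \<in> L" "y \<in> L" using that \<open>a \<in> ?C\<close> \<open>b \<in> ?C\<close> by auto
      then show ?thesis using \<gamma> Ladd by simp
    qed
    show ?thesis
      using that
      by (simp add: skew_group_algebra_def clinear_sum[OF lin] D_single keys_D lookup_D eq
          cong: sum.cong)
  qed
  have act: "D ?g (alg_act ?A z a) = alg_act ?A' z (D ?g a)" if "a \<in> ?C" for z a
    using that
    by (simp add: skew_group_algebra_def clinear_sum[OF lin] D_single keys_D lookup_D)
  show ?thesis
    unfolding halg_iso_def
  proof (intro exI[of _ "D ?g"] conjI ballI allI)
    show "bij_betw (D ?g) (alg_carrier ?A) (alg_carrier ?A')"
      using bij by (simp add: skew_group_algebra_def)
    show "D ?g (alg_one ?A) = alg_one ?A'"
      using \<open>\<gamma> 0 = 1\<close> by (simp add: skew_group_algebra_def D_single del: single_one)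
    show "D ?g (alg_mult ?A a b) = alg_mult ?A' (D ?g a) (D ?g b)"
      if "a \<in> alg_carrier ?A" "b \<in> alg_carrier ?A" for a b
      using that by (intro mult) (simp_all add: skew_group_algebra_def)
    show "D ?g (alg_act ?A z a) = alg_act ?A' z (D ?g a)" if "a \<in> alg_carrier ?A" for z a
      using that by (intro act) (simp add: skew_group_algebra_def)
  qed (simp_all add: lin[unfolded clinear_iff])
qed

section \<open>Algebras with an invariant trace and trivial invariants\<close>

lemma clinear_eq_on_span:
  assumes "clinear f" "clinear g" "\<And>x. x \<in> S \<Longrightarrow> f x = g x" "x \<in> cvs.span S"
  shows "f x = g x"
proof -
  have "cvs.subspace {x. f x = g x}"
    using assms(1,2) by (intro cvs.subspaceI) (auto simp: clinear_0 clinear_iff)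
  then have "cvs.span S \<subseteq> {x. f x = g x}" using assms(3) by (intro cvs.span_minimal) auto
  then show ?thesis using assms(4) by blast
qed

lemma functional_span_nonzero:
  assumes "clinear \<phi>" "b \<in> cvs.span S" "\<phi> b \<noteq> (0::complex)"
  obtains b' where "b' \<in> S" "\<phi> b' \<noteq> 0"
proof -
  have "cvs.subspace {x. \<phi> x = 0}"
    using assms(1) by (intro cvs.subspaceI) (auto simp: clinear_0 clinear_iff scaleC_complex_def)
  then have "\<not> S \<subseteq> {x. \<phi> x = 0}" using assms(2,3) cvs.span_minimal by blast
  then show thesis using that by blast
qed

text \<open>A weight is a linear functional on \<open>'h\<close>; a non-degenerate form encodes it
  by the vector \<open>x\<close> representing it, so that weights live in \<open>'h\<close>
  itself.\<close>

definition weight_space ::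
  "('h \<Rightarrow> 'h \<Rightarrow> complex) \<Rightarrow> ('h \<Rightarrow> 'm::complex_vector \<Rightarrow> 'm) \<Rightarrow> 'h \<Rightarrow> 'm set" where
  "weight_space form \<rho> x = {a. \<forall>z. \<rho> z a = form x z *\<^sub>C a}"

text \<open>The bilinear form is replaced by its trace: \<open>tr_act\<close> expresses that it is a
  morphism to the trivial module, \<open>tr_nondegenerate\<close> its non-degeneracy in the first
  argument.\<close>

locale invariant_trace_algebra =
  fixes form :: "'h::complex_vector \<Rightarrow> 'h \<Rightarrow> complex"
    and \<rho> :: "'h \<Rightarrow> 'a::complex_algebra_1 \<Rightarrow> 'a"
    and tr :: "'a \<Rightarrow> complex"
  assumes fin: "\<exists>B::'h set. finite B \<and> cvs.span B = UNIV"
    and nd: "nondegenerate_symmetric_form form"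
    and alg: "h_algebra \<rho>"
    and invariants: "h_invariants \<rho> = range (\<lambda>c. c *\<^sub>C 1)"
    and tr_linear: "clinear tr"
    and tr_act: "tr (\<rho> z a) = 0"
    and tr_nondegenerate: "(\<And>b. tr (a * b) = 0) \<Longrightarrow> a = 0"
begin

lemma module: "h_module \<rho>" and loc_fin: "locally_finite \<rho>"
  and derivation: "\<rho> z (a * b) = \<rho> z a * b + a * \<rho> z b"
  using alg by (simp_all add: h_algebra_def)

lemmas act_linear = h_moduleD[OF module]

lemma tr_scale: "tr (c *\<^sub>C a) = c * tr a"
  using tr_linear by (simp add: clinear_iff scaleC_complex_def)

lemma form_linear: "clinear (form x)" "clinear (\<lambda>x. form x z)" and form_sym: "form x y = form y x"
  using nd by (simp_all add: nondegenerate_symmetric_form_def cbilinear_def)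

lemma form_left [simp]:
  "form 0 z = 0" "form (x + y) z = form x z + form y z" "form (- x) z = - form x z"
proof -
  show "form 0 z = 0" by (rule clinear_0[OF form_linear(2)])
  show "form (x + y) z = form x z + form y z" for x y
    using form_linear(2) by (simp add: clinear_iff)
  from this[of x "- x"] show "form (- x) z = - form x z"
    using \<open>form 0 z = 0\<close> by (simp add: eq_neg_iff_add_eq_0 add.commute)
qed

lemma form_eq_0: "(\<And>z. form x z = 0) \<Longrightarrow> x = 0"
  using nd by (simp add: nondegenerate_symmetric_form_def)

section \<open>The generalised weight space of weight 0\<close>

lemma act_one: "\<rho> z 1 = 0"
  using derivation[of z 1 1] by simp

text \<open>Otherwise a multiple of \<open>a\<close> would be sent by \<open>z\<close> to 1, and
  \<open>functional_slice_zero\<close> would make the trace vanish identically, which non-degeneracy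
  forbids.\<close>

lemma act_scalar:
  assumes "\<rho> z a = c *\<^sub>C 1"
  shows "c = 0"
proof (rule ccontr)
  assume "c \<noteq> 0"
  then have slice: "\<rho> z ((1 / c) *\<^sub>C a) = 1"
    using assms act_linear(1)[of z] by (simp add: clinear_iff scaleC_scaleC scaleC_one)
  have "tr b = 0" for b
    using loc_fin
    by (intro functional_slice_zero[OF act_linear(1) derivation _ tr_linear tr_act slice])
      (simp add: locally_finite_def)
  then have "(1::'a) = 0" by (intro tr_nondegenerate)
  then show False by simp
qed

text \<open>Induction on the sum of the nilpotency exponents over \<open>U\<close>. Applying
  \<open>\<rho> u\<close> lowers the sum, so \<open>\<rho> u a\<close> is a scalar, and then 0 by
  \<open>act_scalar\<close>; hence \<open>a\<close> is invariant.\<close>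

lemma gen_weight_space_0:
  assumes U: "finite U" "cvs.span U = UNIV" and a: "a \<in> gen_weight_space \<rho> U (\<lambda>_. 0)"
  shows "\<exists>c. a = c *\<^sub>C 1"
proof -
  have "\<exists>c. a = c *\<^sub>C 1" if "\<forall>u\<in>U. (\<rho> u ^^ n u) a = 0" for n :: "'h \<Rightarrow> nat" and a
    using that
  proof (induction "sum n U" arbitrary: n a rule: less_induct)
    case less
    have act_0: "\<rho> u a = 0" if u: "u \<in> U" for u
    proof (cases "n u")
      case 0
      then have "a = 0" using less.prems u by force
      then show ?thesis using clinear_0[OF act_linear(1)] by simp
    next
      case (Suc k)
      define n' where "n' = n(u := k)"
      have "sum n' U < sum n U"
        using U(1) u Suc unfolding n'_def by (intro sum_strict_mono_ex1) auto
      moreover have "(\<rho> v ^^ n' v) (\<rho> u a) = 0" if v: "v \<in> U" for v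
      proof (cases "v = u")
        case True
        then show ?thesis
          using less.prems u Suc by (fastforce simp: n'_def funpow_swap1)
      next
        case False
        have "(\<rho> v ^^ n v) (\<rho> u a) = \<rho> u ((\<rho> v ^^ n v) a)"
          by (rule funpow_commute[symmetric]) (rule act_linear(3))
        then show ?thesis
          using less.prems v False clinear_0[OF act_linear(1)] by (simp add: n'_def)
      qed
      ultimately obtain c where "\<rho> u a = c *\<^sub>C 1" using less.hyps by blast
      then show ?thesis using act_scalar[of u a c] by simp
    qed
    have "\<rho> z a = 0" for z
      by (rule clinear_eq_on_span[of "\<lambda>z. \<rho> z a" "\<lambda>z. 0" U])
        (simp_all add: act_linear act_0 U clinear_iff)
    then have "a \<in> h_invariants \<rho>" by (simp add: h_invariants_def)
    then show ?case unfolding invariants by blast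
  qed
  moreover have "\<exists>n. \<forall>u\<in>U. (\<rho> u ^^ n u) a = 0"
    by (rule bchoice[of U "\<lambda>u n. (\<rho> u ^^ n) a = 0"])
      (use a in \<open>simp add: gen_weight_space_def\<close>)
  ultimately show ?thesis by blast
qed

text \<open>Non-degeneracy provides a partner with nonzero trace against \<open>a\<close>, and it
  can be chosen of some generalised weight \<psi>. The trace kills nonzero generalised weights, so
  \<psi> is opposite to \<chi> on \<open>U\<close> and the product is a nonzero scalar.\<close>

lemma gen_weight_space_right_inverse:
  assumes U: "finite U" "cvs.span U = UNIV" and a: "a \<in> gen_weight_space \<rho> U \<chi>" "a \<noteq> 0"
  shows "\<exists>b\<in>gen_weight_space \<rho> U (\<lambda>u. - \<chi> u). a * b = 1"
proof -
  obtain b where b: "tr (a * b) \<noteq> 0" using tr_nondegenerate a(2) by blast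
  have lin: "clinear (\<lambda>b. tr (a * b))"
    using tr_linear by (simp add: clinear_iff distrib_left mult_scaleC_right)
  obtain b' \<psi> where b': "b' \<in> gen_weight_space \<rho> U \<psi>" "tr (a * b') \<noteq> 0"
    using functional_span_nonzero[OF lin gen_weight_space_span[OF module loc_fin U(1)] b] by blast
  have ab: "a * b' \<in> gen_weight_space \<rho> U (\<lambda>u. \<chi> u + \<psi> u)"
    by (rule gen_weight_space_mult[OF alg a(1) b'(1)])
  have sum_0: "\<chi> u + \<psi> u = 0" if "u \<in> U" for u
  proof (rule ccontr)
    assume nz: "\<chi> u + \<psi> u \<noteq> 0"
    have "\<exists>n. ((\<lambda>v. \<rho> u v - (\<chi> u + \<psi> u) *\<^sub>C v) ^^ n) (a * b') = 0"
      using ab that by (simp add: gen_weight_space_def)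
    then obtain n where "((\<lambda>v. \<rho> u v - (\<chi> u + \<psi> u) *\<^sub>C v) ^^ n) (a * b') = 0" ..
    from functional_gen_eigenvector_zero[OF tr_linear tr_act nz this] show False using b'(2) by simp
  qed
  then have "a * b' \<in> gen_weight_space \<rho> U (\<lambda>_. 0)"
    using ab by (simp add: gen_weight_space_def)
  then obtain c where c: "a * b' = c *\<^sub>C 1" using gen_weight_space_0[OF U] by blast
  then have "c \<noteq> 0" using b'(2) clinear_0[OF tr_linear] by auto
  have "\<psi> u = - \<chi> u" if "u \<in> U" for u using sum_0[OF that] by (simp add: eq_neg_iff_add_eq_0 add.commute)
  then have "b' \<in> gen_weight_space \<rho> U (\<lambda>u. - \<chi> u)"
    using b'(1) by (simp add: gen_weight_space_def)
  then have "(1 / c) *\<^sub>C b' \<in> gen_weight_space \<rho> U (\<lambda>u. - \<chi> u)"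
    using act_linear(1)
    by (intro gen_weight_space_stable[where S = "scaleC (1 / c)"])
      (simp_all add: clinear_iff scaleC_add_right mult.commute)
  moreover have "a * ((1 / c) *\<^sub>C b') = 1"
    using \<open>c \<noteq> 0\<close> by (simp add: mult_scaleC_right c scaleC_scaleC scaleC_one)
  ultimately show ?thesis by blast
qed

text \<open>A right inverse \<open>b\<close> of \<open>a\<close> has a right inverse of its own,
  which must equal \<open>a\<close>; so \<open>b\<close> is two-sided.\<close>

lemma gen_weight_space_inverse:
  assumes U: "finite U" "cvs.span U = UNIV" and a: "a \<in> gen_weight_space \<rho> U \<chi>" "a \<noteq> 0"
  shows "\<exists>b\<in>gen_weight_space \<rho> U (\<lambda>u. - \<chi> u). a * b = 1 \<and> b * a = 1"
proof -
  obtain b where b: "b \<in> gen_weight_space \<rho> U (\<lambda>u. - \<chi> u)" "a * b = 1"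
    using gen_weight_space_right_inverse[OF assms] by blast
  then have "b \<noteq> 0" by auto
  then obtain c where "b * c = 1"
    using gen_weight_space_right_inverse[OF U b(1)] by blast
  then have "c = a" using b(2) by (metis mult.assoc mult_1_left mult_1_right)
  then show ?thesis using b \<open>b * c = 1\<close> by blast
qed

section \<open>From generalised to genuine weights\<close>

lemma orthonormal_basis_finite: "orthonormal_basis form U \<Longrightarrow> finite U"
  using fin cvs.independent_span_bound unfolding orthonormal_basis_def by (metis top_greatest)

lemma form_represents:
  assumes "clinear c"
  shows "\<exists>x. \<forall>z. c z = form x z"
proof -
  obtain U where U: "orthonormal_basis form U" using orthonormal_basis_exists[OF fin nd] ..
  have finU: "finite U" by (rule orthonormal_basis_finite[OF U])
  define x where "x = (\<Sum>u\<in>U. c u *\<^sub>C u)"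
  have "c z = form x z" for z
  proof (rule clinear_eq_on_span[OF assms form_linear(1)])
    show "z \<in> cvs.span U" using U by (simp add: orthonormal_basis_def)
    fix v assume "v \<in> U"
    have "form x v = (\<Sum>u\<in>U. form (c u *\<^sub>C u) v)"
      unfolding x_def by (rule clinear_sum[OF form_linear(2)])
    also have "\<dots> = (\<Sum>u\<in>U. if u = v then c v else 0)"
      using U \<open>v \<in> U\<close> form_linear(2)
      by (intro sum.cong) (auto simp: orthonormal_basis_def clinear_iff scaleC_complex_def)
    also have "\<dots> = c v" using finU \<open>v \<in> U\<close> by simp
    finally show "c v = form x v" ..
  qed
  then show ?thesis by blast
qed

text \<open>With \<open>b\<close> inverse to \<open>a\<close>, the product
  \<open>b * \<rho> z a\<close> has generalised weight 0 and is a scalar, so \<open>a\<close> is an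
  eigenvector of every \<open>\<rho> z\<close>. The eigenvalue is linear in \<open>z\<close>, hence
  represented by a vector \<open>x\<close>.\<close>

lemma gen_weight_space_weight:
  assumes U: "finite U" "cvs.span U = UNIV" and a: "a \<in> gen_weight_space \<rho> U \<chi>"
  shows "\<exists>x. a \<in> weight_space form \<rho> x"
proof (cases "a = 0")
  case True
  then show ?thesis using clinear_0[OF act_linear(1)] by (simp add: weight_space_def)
next
  case False
  obtain b where b: "b \<in> gen_weight_space \<rho> U (\<lambda>u. - \<chi> u)" "a * b = 1" "b * a = 1"
    using gen_weight_space_inverse[OF U a False] by blast
  have "\<exists>c. \<rho> z a = c *\<^sub>C a" for z
  proof -
    have "\<rho> z a \<in> gen_weight_space \<rho> U \<chi>"
      by (rule gen_weight_space_stable[OF act_linear(1) act_linear(3) a])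
    from gen_weight_space_mult[OF alg b(1) this]
    have "b * \<rho> z a \<in> gen_weight_space \<rho> U (\<lambda>_. 0)" by simp
    then obtain c where "b * \<rho> z a = c *\<^sub>C 1" using gen_weight_space_0[OF U] by blast
    then have "a * (b * \<rho> z a) = c *\<^sub>C a" by (simp add: mult_scaleC_right)
    then have "\<rho> z a = c *\<^sub>C a" by (simp add: b(2) flip: mult.assoc)
    then show ?thesis ..
  qed
  then obtain c where c: "\<And>z. \<rho> z a = c z *\<^sub>C a" by metis
  have "c (x + y) = c x + c y" "c (k *\<^sub>C x) = k * c x" for x y k
  proof -
    have "\<rho> (x + y) a = \<rho> x a + \<rho> y a" "\<rho> (k *\<^sub>C x) a = k *\<^sub>C \<rho> x a"
      using act_linear(2)[of a] by (simp_all add: clinear_iff)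
    then show "c (x + y) = c x + c y" "c (k *\<^sub>C x) = k * c x"
      using False by (simp_all add: c scaleC_scaleC flip: scaleC_add_left)
  qed
  then have "clinear c" by (simp add: clinear_iff scaleC_complex_def)
  then obtain x where "\<forall>z. c z = form x z" using form_represents by blast
  then show ?thesis using c by (auto simp: weight_space_def)
qed

section \<open>Genuine weight spaces\<close>

abbreviation "W \<equiv> weight_space form \<rho>"

lemma weight_space_span: "a \<in> cvs.span (\<Union>x. W x)"
proof -
  obtain U where U: "orthonormal_basis form U" using orthonormal_basis_exists[OF fin nd] ..
  have fU: "finite U" "cvs.span U = UNIV"
    using orthonormal_basis_finite[OF U] U by (simp_all add: orthonormal_basis_def)
  have "(\<Union>\<chi>. gen_weight_space \<rho> U \<chi>) \<subseteq> (\<Union>x. W x)"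
    using gen_weight_space_weight[OF fU] by blast
  then show ?thesis using gen_weight_space_span[OF module loc_fin fU(1)] cvs.span_mono by blast
qed

lemma weight_space_mult: "a \<in> W x \<Longrightarrow> b \<in> W y \<Longrightarrow> a * b \<in> W (x + y)"
  by (simp add: weight_space_def derivation mult_scaleC_left mult_scaleC_right scaleC_add_left)

lemma weight_space_scale: "a \<in> W x \<Longrightarrow> c *\<^sub>C a \<in> W x"
  using act_linear(1) by (simp add: weight_space_def clinear_iff mult.commute)

lemma one_weight: "1 \<in> W 0"
  by (simp add: weight_space_def act_one)

lemma weight_space_0:
  assumes "a \<in> W 0"
  shows "\<exists>c. a = c *\<^sub>C 1"
proof -
  have "a \<in> h_invariants \<rho>" using assms by (simp add: weight_space_def h_invariants_def)
  then show ?thesis unfolding invariants by blast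
qed

lemma tr_weight_space:
  assumes "a \<in> W x" "x \<noteq> 0"
  shows "tr a = 0"
proof -
  obtain z where "form x z \<noteq> 0" using assms(2) form_eq_0 by blast
  moreover have "form x z * tr a = 0"
    using tr_act[of z a] assms(1) by (simp add: weight_space_def tr_scale)
  ultimately show ?thesis by simp
qed

text \<open>The trace argument for generalised weight spaces is repeated here so that the inverse
  has genuine weight exactly \<open>- x\<close>.\<close>

lemma weight_space_right_inverse:
  assumes "a \<in> W x" "a \<noteq> 0"
  shows "\<exists>b\<in>W (- x). a * b = 1"
proof -
  obtain b where b: "tr (a * b) \<noteq> 0" using tr_nondegenerate assms(2) by blast
  have lin: "clinear (\<lambda>b. tr (a * b))"
    using tr_linear by (simp add: clinear_iff distrib_left mult_scaleC_right)
  obtain b' y where b': "b' \<in> W y" "tr (a * b') \<noteq> 0"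
    using functional_span_nonzero[OF lin weight_space_span b] by blast
  have ab: "a * b' \<in> W (x + y)" by (rule weight_space_mult[OF assms(1) b'(1)])
  then have xy: "x + y = 0" using tr_weight_space b'(2) by blast
  then obtain c where c: "a * b' = c *\<^sub>C 1" using ab weight_space_0 by auto
  then have "c \<noteq> 0" using b'(2) clinear_0[OF tr_linear] by auto
  have "y = - x" using xy by (simp add: eq_neg_iff_add_eq_0 add.commute)
  then have "(1 / c) *\<^sub>C b' \<in> W (- x)" using b'(1) weight_space_scale by simp
  moreover have "a * ((1 / c) *\<^sub>C b') = 1"
    using \<open>c \<noteq> 0\<close> by (simp add: mult_scaleC_right c scaleC_scaleC scaleC_one)
  ultimately show ?thesis by blast
qed

lemma weight_space_inverse:
  assumes a: "a \<in> W x" "a \<noteq> 0"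
  shows "\<exists>b\<in>W (- x). a * b = 1 \<and> b * a = 1"
proof -
  obtain b where b: "b \<in> W (- x)" "a * b = 1" using weight_space_right_inverse[OF a] by blast
  then have "b \<noteq> 0" by auto
  then obtain c where "b * c = 1" using weight_space_right_inverse[OF b(1)] by blast
  then have "c = a" using b(2) by (metis mult.assoc mult_1_left mult_1_right)
  then show ?thesis using b \<open>b * c = 1\<close> by blast
qed

lemma weight_space_mult_nonzero:
  assumes "a \<in> W x" "a \<noteq> 0" "b \<noteq> 0"
  shows "a * b \<noteq> 0"
proof
  assume "a * b = 0"
  moreover obtain a' where "a' * a = 1" using weight_space_inverse[OF assms(1,2)] by blast
  ultimately show False using assms(3) by (metis mult.assoc mult_1_left mult_zero_right)
qed

text \<open>Multiplication by an inverse of \<open>a\<close> carries \<open>W x\<close> into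
  \<open>W 0\<close>, which consists of scalars.\<close>

lemma weight_space_1dim:
  assumes a: "a \<in> W x" "a \<noteq> 0" and b: "b \<in> W x"
  shows "\<exists>c. b = c *\<^sub>C a"
proof -
  obtain a' where a': "a' \<in> W (- x)" "a * a' = 1" using weight_space_right_inverse[OF a] ..
  have "a' * b \<in> W 0" using weight_space_mult[OF a'(1) b] by simp
  then obtain c where "a' * b = c *\<^sub>C 1" using weight_space_0 by blast
  then have "a * (a' * b) = c *\<^sub>C a" by (simp add: mult_scaleC_right)
  then show ?thesis using a'(2) by (auto simp flip: mult.assoc)
qed

text \<open>The trace is not identically zero, and it vanishes on all weights except 0, where only
  multiples of 1 remain. This is what lets the trace read off coefficients.\<close>

lemma tr_one: "tr 1 \<noteq> 0"
proof -
  obtain a where a: "tr a \<noteq> 0" using tr_nondegenerate[of 1] by auto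
  obtain b y where b: "b \<in> W y" "tr b \<noteq> 0"
    using functional_span_nonzero[OF tr_linear weight_space_span a] by blast
  then have "y = 0" using tr_weight_space by blast
  then obtain c where "b = c *\<^sub>C 1" using b(1) weight_space_0 by blast
  then show ?thesis using b(2) by (auto simp: tr_scale)
qed

section \<open>The group of weights and the skew group algebra\<close>

definition weights :: "'h set" where
  "weights = {x. \<exists>a\<in>W x. a \<noteq> 0}"

lemma weights_subgroup: "add_subgroup weights"
  unfolding add_subgroup_def
proof (intro conjI ballI)
  have "(1::'a) \<noteq> 0" by simp
  then show "0 \<in> weights" using one_weight unfolding weights_def by blast
  show "x + y \<in> weights" if "x \<in> weights" "y \<in> weights" for x y
    using that weight_space_mult weight_space_mult_nonzero unfolding weights_def by blast
  show "- x \<in> weights" if x: "x \<in> weights" for x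
  proof -
    obtain a b where "b \<in> W (- x)" "a * b = 1"
      using x weight_space_inverse unfolding weights_def by blast
    moreover from this have "b \<noteq> 0" by auto
    ultimately show ?thesis unfolding weights_def by blast
  qed
qed

text \<open>A choice of one nonzero vector \<open>e x\<close> in each weight space gives a basis
  whose structure constants are \<alpha>; the cocycle identity is associativity of the
  product.\<close>

lemma skew_group_algebra_iso:
  "\<exists>\<alpha>. normalised_cocycle weights \<alpha> \<and> full_halg \<rho> \<cong>\<^sub>h skew_group_algebra form weights \<alpha>"
proof -
  \<comment> \<open>Choosing 1 in weight 0 makes \<alpha> normalised and lets the unit of the skew
    group algebra go to 1.\<close>
  define e where "e x = (if x = 0 then 1 else SOME a. a \<in> W x \<and> a \<noteq> 0)" for x
  have e0: "e 0 = 1" by (simp add: e_def)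
  have e: "e x \<in> W x" "e x \<noteq> 0" if "x \<in> weights" for x
    using that someI_ex[of "\<lambda>a. a \<in> W x \<and> a \<noteq> 0"] one_weight
    by (auto simp: e_def weights_def)
  have L0: "0 \<in> weights" and Ladd: "x \<in> weights \<Longrightarrow> y \<in> weights \<Longrightarrow> x + y \<in> weights" for x y
    using weights_subgroup by (simp_all add: add_subgroup_def)
  define \<alpha> where "\<alpha> x y = (SOME c. e x * e y = c *\<^sub>C e (x + y))" for x y
  have \<alpha>: "e x * e y = \<alpha> x y *\<^sub>C e (x + y)" if "x \<in> weights" "y \<in> weights" for x y
    unfolding \<alpha>_def
    by (rule someI_ex, rule weight_space_1dim)
      (use that e Ladd weight_space_mult in blast)+
  have cancel: "c = d" if "c *\<^sub>C e x = d *\<^sub>C e x" "x \<in> weights" for c d x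
    using that e(2) cvs.scale_right_imp_eq by blast
  have coc: "normalised_cocycle weights \<alpha>"
    unfolding normalised_cocycle_def
  proof (intro conjI ballI)
    fix x y assume x: "x \<in> weights" and y: "y \<in> weights"
    have "e x * e y \<noteq> 0" using weight_space_mult_nonzero e x y by blast
    then show "\<alpha> x y \<noteq> 0" unfolding \<alpha>[OF x y] by auto
    fix z assume z: "z \<in> weights"
    have "(\<alpha> y z * \<alpha> x (y + z)) *\<^sub>C e (x + (y + z)) = e x * (e y * e z)"
      using x y z by (simp add: \<alpha> Ladd mult_scaleC_right scaleC_scaleC)
    also have "\<dots> = (e x * e y) * e z" by (simp add: mult.assoc)
    also have "\<dots> = (\<alpha> (x + y) z * \<alpha> x y) *\<^sub>C e (x + (y + z))"
      using x y z by (simp add: \<alpha> Ladd mult_scaleC_left scaleC_scaleC add.assoc mult.commute)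
    finally show "\<alpha> y z * \<alpha> x (y + z) = \<alpha> (x + y) z * \<alpha> x y"
      by (rule cancel) (intro Ladd x y z)
  next
    fix x assume x: "x \<in> weights"
    show "\<alpha> x 0 = 1" "\<alpha> 0 x = 1"
      using \<alpha>[OF x L0] \<alpha>[OF L0 x] cancel[OF _ x, of _ 1] by (simp_all add: e0 scaleC_one)
  qed
  define \<Phi> where "\<Phi> = free_lift e"
  have lin: "clinear \<Phi>" unfolding \<Phi>_def by (rule clinear_free_lift)
  interpret L: Vector_Spaces.linear scaleC scaleC \<Phi> by (rule lin)
  have single: "\<Phi> (Poly_Mapping.single x c) = c *\<^sub>C e x" for x c
    by (simp add: \<Phi>_def)
  have \<Phi>_eq: "\<Phi> f = (\<Sum>x\<in>Poly_Mapping.keys f. Poly_Mapping.lookup f x *\<^sub>C e x)" for f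
    by (simp add: \<Phi>_def free_lift_def)
  let ?C = "{f :: 'h \<Rightarrow>\<^sub>0 complex. Poly_Mapping.keys f \<subseteq> weights}"
  \<comment> \<open>Independence of the \<open>e x\<close>: after multiplication by the inverse of
    \<open>e x\<close>, the trace kills every term except the one at \<open>x\<close>, which
    contributes its coefficient times \<open>tr 1\<close>.\<close>
  have coeff: "f = 0" if f: "f \<in> ?C" "\<Phi> f = 0" for f
  proof (rule ccontr)
    assume "f \<noteq> 0"
    then obtain x where x: "x \<in> Poly_Mapping.keys f" by (meson ex_in_conv keys_eq_empty)
    then have xL: "x \<in> weights" using f(1) by blast
    obtain b where b: "b \<in> W (- x)" "e x * b = 1"
      using weight_space_inverse[OF e[OF xL]] by blast
    have "tr (e y * b) = (if y = x then tr 1 else 0)" if "y \<in> weights" for y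
      using tr_weight_space[OF weight_space_mult[OF e(1)[OF that] b(1)]] b(2) by auto
    then have "(\<Sum>y\<in>Poly_Mapping.keys f. Poly_Mapping.lookup f y * tr (e y * b)) =
        (\<Sum>y\<in>Poly_Mapping.keys f. if y = x then Poly_Mapping.lookup f x * tr 1 else 0)"
      using f(1) by (intro sum.cong) auto
    also have "\<dots> = Poly_Mapping.lookup f x * tr 1" using x by simp
    also have "(\<Sum>y\<in>Poly_Mapping.keys f. Poly_Mapping.lookup f y * tr (e y * b)) = tr (\<Phi> f * b)"
      by (simp add: \<Phi>_eq sum_distrib_right clinear_sum[OF tr_linear] mult_scaleC_left tr_scale)
    finally show False using f(2) x tr_one clinear_0[OF tr_linear] by (simp add: in_keys_iff)
  qed
  have sub: "cvs.subspace ?C" by (rule keys_subset_subspace)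
  have "inj_on \<Phi> ?C"
  proof (rule inj_onI)
    fix f g assume fg: "f \<in> ?C" "g \<in> ?C" "\<Phi> f = \<Phi> g"
    have "f - g = 0"
      using fg by (intro coeff cvs.subspace_diff[OF sub]) (simp_all add: clinear_diff[OF lin])
    then show "f = g" by simp
  qed
  moreover have "a \<in> \<Phi> ` ?C" for a
  proof -
    have "cvs.span (\<Union>x. W x) \<subseteq> \<Phi> ` ?C"
    proof (rule cvs.span_minimal)
      show img: "cvs.subspace (\<Phi> ` ?C)" by (rule L.subspace_image[OF sub])
      show "(\<Union>x. W x) \<subseteq> \<Phi> ` ?C"
      proof clarify
        fix x a assume a: "a \<in> W x"
        show "a \<in> \<Phi> ` ?C"
        proof (cases "a = 0")
          case True
          then show ?thesis using cvs.subspace_0[OF img] by simp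
        next
          case False
          then have x: "x \<in> weights" using a by (auto simp: weights_def)
          then obtain c where "a = c *\<^sub>C e x" using weight_space_1dim e a by blast
          then have "a = \<Phi> (Poly_Mapping.single x c)" by (simp add: single)
          moreover have "Poly_Mapping.single x c \<in> ?C" using x by simp
          ultimately show ?thesis by blast
        qed
      qed
    qed
    then show ?thesis using weight_space_span by blast
  qed
  ultimately have bij: "bij_betw \<Phi> ?C UNIV" by (auto simp: bij_betw_def)
  let ?S = "skew_group_algebra form weights \<alpha>"
  have car: "alg_carrier ?S = ?C" by (simp add: skew_group_algebra_def)
  have mult: "\<Phi> (alg_mult ?S f g) = \<Phi> f * \<Phi> g" if "f \<in> ?C" "g \<in> ?C" for f g
  proof -
    have "\<Phi> f * \<Phi> g = (\<Sum>x\<in>Poly_Mapping.keys f. \<Sum>y\<in>Poly_Mapping.keys g.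
        (Poly_Mapping.lookup f x *\<^sub>C e x) * (Poly_Mapping.lookup g y *\<^sub>C e y))"
      by (simp add: \<Phi>_eq sum_product)
    also have "\<dots> = (\<Sum>x\<in>Poly_Mapping.keys f. \<Sum>y\<in>Poly_Mapping.keys g.
        (Poly_Mapping.lookup f x * Poly_Mapping.lookup g y * \<alpha> x y) *\<^sub>C e (x + y))"
    proof (intro sum.cong refl)
      fix x y assume "x \<in> Poly_Mapping.keys f" "y \<in> Poly_Mapping.keys g"
      then have "e x * e y = \<alpha> x y *\<^sub>C e (x + y)" using that by (intro \<alpha>) auto
      then show "(Poly_Mapping.lookup f x *\<^sub>C e x) * (Poly_Mapping.lookup g y *\<^sub>C e y) =
          (Poly_Mapping.lookup f x * Poly_Mapping.lookup g y * \<alpha> x y) *\<^sub>C e (x + y)"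
        by (simp add: mult_scaleC_left mult_scaleC_right scaleC_scaleC mult.assoc mult.left_commute)
    qed
    also have "\<dots> = \<Phi> (alg_mult ?S f g)"
      by (simp add: skew_group_algebra_def clinear_sum[OF lin] single)
    finally show ?thesis ..
  qed
  have act: "\<Phi> (alg_act ?S z f) = \<rho> z (\<Phi> f)" if "f \<in> ?C" for z f
  proof -
    have "\<rho> z (e x) = form x z *\<^sub>C e x" if "x \<in> weights" for x
      using e(1)[OF that] by (simp add: weight_space_def)
    then have "\<rho> z (Poly_Mapping.lookup f x *\<^sub>C e x) = (form x z * Poly_Mapping.lookup f x) *\<^sub>C e x"
      if "x \<in> Poly_Mapping.keys f" for x
      using that \<open>f \<in> ?C\<close> act_linear(1)[of z]
      by (simp add: clinear_iff subset_iff scaleC_scaleC mult.commute)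
    then show ?thesis
      by (simp add: skew_group_algebra_def \<Phi>_eq[of f] clinear_sum[OF lin]
          clinear_sum[OF act_linear(1)] single)
  qed
  \<comment> \<open>The map out of the skew group algebra is the explicit one, by linear extension;
    its inverse then gives the required direction.\<close>
  have "?S \<cong>\<^sub>h full_halg \<rho>"
    unfolding halg_iso_def
  proof (intro exI[of _ \<Phi>] conjI ballI allI)
    show "bij_betw \<Phi> (alg_carrier ?S) (alg_carrier (full_halg \<rho>))"
      using bij by (simp add: car full_halg_def)
    show "\<Phi> (alg_one ?S) = alg_one (full_halg \<rho>)"
      by (simp add: skew_group_algebra_def full_halg_def single e0 scaleC_one del: single_one)
    show "\<Phi> (alg_mult ?S f g) = alg_mult (full_halg \<rho>) (\<Phi> f) (\<Phi> g)"
      if "f \<in> alg_carrier ?S" "g \<in> alg_carrier ?S" for f g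
      using mult that unfolding car by (simp add: full_halg_def)
    show "\<Phi> (alg_act ?S z f) = alg_act (full_halg \<rho>) z (\<Phi> f)" if "f \<in> alg_carrier ?S" for z f
      using act that unfolding car by (simp add: full_halg_def)
  qed (simp_all add: lin[unfolded clinear_iff])
  then have "full_halg \<rho> \<cong>\<^sub>h ?S"
    by (rule halg_iso_sym[rotated 5])
      (simp_all add: skew_group_algebra_closed[OF weights_subgroup])
  then show ?thesis using coc by blast
qed

end

section \<open>Braided commutativity\<close>

lemma braided_commutative_weight_spaces:
  fixes form :: "'h::complex_vector \<Rightarrow> 'h \<Rightarrow> complex" and \<rho> :: "'h \<Rightarrow> 'a::complex_algebra_1 \<Rightarrow> 'a"
  assumes fin: "\<exists>B::'h set. finite B \<and> cvs.span B = UNIV"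
    and nd: "nondegenerate_symmetric_form form"
    and "h_module \<rho>" "braided_commutative form \<rho>"
    and a: "a \<in> weight_space form \<rho> x" and b: "b \<in> weight_space form \<rho> y"
  shows "a * b = exp (of_real pi * \<i> * form x y) *\<^sub>C (b * a)"
proof -
  have bil: "cbilinear ((*) :: 'a \<Rightarrow> 'a \<Rightarrow> 'a)"
    by (simp add: cbilinear_def clinear_iff algebra_simps mult_scaleC_left mult_scaleC_right)
  have "a * b = mult_map (braiding form \<rho> \<rho> (a \<otimes>\<^sub>t b))"
    using assms(4) by (simp add: braided_commutative_def)
  also have "braiding form \<rho> \<rho> (a \<otimes>\<^sub>t b) = exp (of_real pi * \<i> * form x y) *\<^sub>C (b \<otimes>\<^sub>t a)"
    using a b by (intro braiding_weight_vectors[OF fin nd assms(3,3)]) (auto simp: weight_space_def)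
  also have "mult_map \<dots> = exp (of_real pi * \<i> * form x y) *\<^sub>C (b * a)"
    using clinear_tensor_lift[OF bil]
    by (simp add: mult_map_def clinear_iff tensor_lift_pure[OF bil])
  finally show ?thesis .
qed

text \<open>As \<open>w\<close> is complex, its imaginary part must be excluded first: the modulus
  of the exponential is 1 only if \<open>Im w = 0\<close>. The cosine then determines the real
  part.\<close>

lemma exp_pi_i_eq_1:
  assumes "exp (of_real pi * \<i> * w) = 1"
  shows "\<exists>n::int. w = 2 * of_int n"
proof -
  let ?z = "of_real pi * \<i> * w"
  have "exp (Re ?z) = 1" using assms by (metis norm_exp_eq_Re norm_one)
  then have im: "Im w = 0" by simp
  have "cos (Im ?z) = 1"
    using arg_cong[OF assms, of Re] \<open>exp (Re ?z) = 1\<close> by (simp add: Re_exp)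
  then obtain n :: int where "pi * Re w = of_int n * 2 * pi"
    unfolding cos_one_2pi_int by auto
  then have "Re w = 2 * of_int n" by simp
  then have "w = 2 * of_int n" using im by (intro complex_eqI) simp_all
  then show ?thesis ..
qed

context invariant_trace_algebra
begin

lemma integral_even_weights:
  assumes "braided_commutative form \<rho>"
  shows "integral_even_on form weights"
proof -
  have even: "\<exists>n::int. form x x = 2 * of_int n" if "x \<in> weights" for x
  proof -
    obtain a where a: "a \<in> W x" "a \<noteq> 0" using \<open>x \<in> weights\<close> by (auto simp: weights_def)
    \<comment> \<open>Commuting \<open>a\<close> past itself: since \<open>a * a\<close> is nonzero,
      the braiding factor must be 1.\<close>
    have "1 *\<^sub>C (a * a) = exp (of_real pi * \<i> * form x x) *\<^sub>C (a * a)"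
      using braided_commutative_weight_spaces[OF fin nd module assms a(1) a(1)]
      by (simp add: scaleC_one)
    moreover have "a * a \<noteq> 0" using weight_space_mult_nonzero a by blast
    ultimately have "exp (of_real pi * \<i> * form x x) = 1"
      using cvs.scale_right_imp_eq by metis
    then show ?thesis by (rule exp_pi_i_eq_1)
  qed
  have "form x y \<in> \<int>" if x: "x \<in> weights" and y: "y \<in> weights" for x y
  proof -
    have "x + y \<in> weights" using weights_subgroup x y by (simp add: add_subgroup_def)
    then obtain l m n :: int where lmn: "form x x = 2 * of_int l" "form y y = 2 * of_int m"
      "form (x + y) (x + y) = 2 * of_int n"
      using even x y by metis
    have "form (x + y) (x + y) = form x x + 2 * form x y + form y y"
      using form_sym[of x "x + y"] form_sym[of y "x + y"] form_sym[of y x] by simp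
    then have "2 * form x y = 2 * of_int (n - l - m)" unfolding lmn by (simp add: algebra_simps)
    then have "form x y = of_int (n - l - m)" by (simp del: of_int_diff)
    then show ?thesis by (simp only: Ints_of_int)
  qed
  then show ?thesis using even by (simp add: integral_even_on_def)
qed

text \<open>This concerns an arbitrary isomorphism. By equivariance and injectivity the preimages of
  the basis vectors are weight vectors of \<open>A\<close>, and braided commutativity there, carried
  back, compares \<open>\<alpha> x y\<close> with \<open>\<alpha> y x\<close>.\<close>

lemma skew_group_algebra_iso_commutator:
  assumes comm: "braided_commutative form \<rho>" and coc: "normalised_cocycle L \<alpha>"
    and iso: "full_halg \<rho> \<cong>\<^sub>h skew_group_algebra form L \<alpha>"
  shows "commutator_condition form L \<alpha>"
  unfolding commutator_condition_def
proof (intro ballI)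
  let ?S = "skew_group_algebra form L \<alpha>"
  obtain f where bij: "bij_betw f UNIV {p. Poly_Mapping.keys p \<subseteq> L}"
    and scale: "\<And>c a. f (c *\<^sub>C a) = c *\<^sub>C f a"
    and mult: "\<And>a b. f (a * b) = alg_mult ?S (f a) (f b)"
    and act: "\<And>z a. f (\<rho> z a) = alg_act ?S z (f a)"
    using iso unfolding halg_iso_def full_halg_def by (auto simp: skew_group_algebra_def)
  have preimage: "\<exists>a\<in>W x. f a = Poly_Mapping.single x 1" if "x \<in> L" for x
  proof -
    have "Poly_Mapping.single x (1::complex) \<in> {p. Poly_Mapping.keys p \<subseteq> L}" using that by simp
    then have "Poly_Mapping.single x 1 \<in> range f" using bij by (simp add: bij_betw_def)
    then obtain a where a: "f a = Poly_Mapping.single x 1" by (metis rangeE)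
    have "f (\<rho> z a) = f (form x z *\<^sub>C a)" for z
      by (simp add: act scale a skew_group_algebra_basis)
    then have "\<rho> z a = form x z *\<^sub>C a" for z using bij by (auto simp: bij_betw_def dest: injD)
    then show ?thesis using a by (auto simp: weight_space_def)
  qed
  fix x y assume x: "x \<in> L" and y: "y \<in> L"
  obtain a b where a: "a \<in> W x" "f a = Poly_Mapping.single x 1"
    and b: "b \<in> W y" "f b = Poly_Mapping.single y 1"
    using preimage x y by metis
  let ?c = "exp (of_real pi * \<i> * form x y)"
  have "f (a * b) = ?c *\<^sub>C f (b * a)"
    using braided_commutative_weight_spaces[OF fin nd module comm a(1) b(1)] scale by metis
  then have "Poly_Mapping.single (x + y) (\<alpha> x y) = Poly_Mapping.single (x + y) (?c * \<alpha> y x)"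
    by (simp add: mult a b skew_group_algebra_basis scaleC_single add.commute)
  then have "\<alpha> x y = ?c * \<alpha> y x" by (metis lookup_single_eq)
  moreover have "\<alpha> y x \<noteq> 0" using coc x y by (simp add: normalised_cocycle_def)
  ultimately show "\<alpha> x y / \<alpha> y x = ?c" by simp
qed

end

theorem theorem4p4:
  fixes form :: "'h::complex_vector \<Rightarrow> 'h \<Rightarrow> complex"
    and \<rho> :: "'h \<Rightarrow> 'a::complex_algebra_1 \<Rightarrow> 'a"
  assumes "\<exists>B::'h set. finite B \<and> cvs.span B = UNIV"
    and "nondegenerate_symmetric_form form"
    and "h_algebra \<rho>"
    and "braided_commutative form \<rho>"
    and "\<exists>\<beta>. h_morphism (tensor_action \<rho> \<rho>) trivial_action \<beta> \<and>
             multiplicative_form \<beta> \<and> nondegenerate_form \<beta>"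
    and "h_invariants \<rho> = range (\<lambda>c. c *\<^sub>C 1)"
  shows "\<exists>L. add_subgroup L \<and> integral_even_on form L \<and>
           (\<exists>\<alpha>. normalised_cocycle L \<alpha> \<and> full_halg \<rho> \<cong>\<^sub>h skew_group_algebra form L \<alpha>) \<and>
           (\<forall>\<alpha>. normalised_cocycle L \<alpha> \<and> full_halg \<rho> \<cong>\<^sub>h skew_group_algebra form L \<alpha> \<longrightarrow>
                commutator_condition form L \<alpha>) \<and>
           (\<forall>\<alpha> \<alpha>'. normalised_cocycle L \<alpha> \<and> commutator_condition form L \<alpha> \<and>
                   normalised_cocycle L \<alpha>' \<and> commutator_condition form L \<alpha>' \<longrightarrow>
                cohomologous L \<alpha> \<alpha>' \<and>
                skew_group_algebra form L \<alpha> \<cong>\<^sub>h skew_group_algebra form L \<alpha>')"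
proof -
  obtain \<beta> where mor: "h_morphism (tensor_action \<rho> \<rho>) trivial_action \<beta>"
    and mul: "multiplicative_form \<beta>" and nondeg: "nondegenerate_form \<beta>"
    using assms(5) by blast
  have lin: "clinear \<beta>" using mor by (simp add: h_morphism_def)
  have mod: "h_module \<rho>" and der: "\<rho> z (a * b) = \<rho> z a * b + a * \<rho> z b" for z a b
    using assms(3) by (simp_all add: h_algebra_def)
  define tr where "tr a = \<beta> (a \<otimes>\<^sub>t 1)" for a
  \<comment> \<open>Multiplicativity with third argument 1.\<close>
  have \<beta>_tr: "\<beta> (a \<otimes>\<^sub>t b) = tr (a * b)" for a b
    using mul unfolding multiplicative_form_def tr_def by (metis mult_1_right)
  interpret invariant_trace_algebra form \<rho> tr
  proof (rule invariant_trace_algebra.intro)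
    show "clinear tr" using lin by (simp add: clinear_iff tr_def pure_tensor_bilinear)
    \<comment> \<open>Invariance of \<beta> is applied to \<open>a \<otimes>\<^sub>t 1\<close>; the
      second term drops out because a derivation kills 1.\<close>
    show "tr (\<rho> z a) = 0" for z a
    proof -
      have "\<rho> z 1 = 0" using der[of z 1 1] by simp
      have "clinear id" by (simp add: clinear_iff)
      have "\<beta> (tensor_action \<rho> \<rho> z (a \<otimes>\<^sub>t 1)) = 0"
        using mor by (simp add: h_morphism_def trivial_action_def)
      then have "\<beta> (\<rho> z a \<otimes>\<^sub>t 1) + \<beta> (a \<otimes>\<^sub>t \<rho> z 1) = 0"
        using lin \<open>clinear id\<close> h_moduleD(1)[OF mod]
        by (simp add: tensor_action_def tensor_map_pure clinear_iff)
      moreover have "\<beta> (a \<otimes>\<^sub>t \<rho> z 1) = 0"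
        using clinear_0[OF lin] clinear_0[of "\<lambda>y. \<beta> (a \<otimes>\<^sub>t y)"] lin
        unfolding \<open>\<rho> z 1 = 0\<close> by (simp add: clinear_iff pure_tensor_bilinear)
      ultimately show ?thesis by (simp add: tr_def)
    qed
    show "a = 0" if "\<And>b. tr (a * b) = 0" for a
      using nondeg that unfolding nondegenerate_form_def \<beta>_tr by blast
  qed (fact assms)+
  have "cohomologous weights \<alpha> \<alpha>' \<and>
      skew_group_algebra form weights \<alpha> \<cong>\<^sub>h skew_group_algebra form weights \<alpha>'"
    if "normalised_cocycle weights \<alpha>" "commutator_condition form weights \<alpha>"
      "normalised_cocycle weights \<alpha>'" "commutator_condition form weights \<alpha>'" for \<alpha> \<alpha>'
    using commutator_condition_cohomologous[OF weights_subgroup that]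
      cohomologous_halg_iso[OF weights_subgroup _ that(1,3)] by blast
  then show ?thesis
    using weights_subgroup integral_even_weights[OF assms(4)] skew_group_algebra_iso
      skew_group_algebra_iso_commutator[OF assms(4)]
    by (intro exI[of _ weights]) blast
qed

end
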